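(* The functors $\mathrm{K}$ and $\mathrm{C}$ establish a categorical equivalence between $\mathsf{Hil}_0$ and $\mathsf{KHil}_0^{\mathrm{CK}}$, with natural isomorphisms $\alpha:\mathrm{Id}\Rightarrow \mathrm{C}\circ\mathrm{K}$ and $\beta:\mathrm{Id}\Rightarrow\mathrm{K}\circ\mathrm{C}$.
   Context: A Hilbert algebra is an algebra $(H,\to,1)$ such that $a\to(b\to a)=1$, $a\to(b\to d)=(a\to b)\to(a\to d)$, and $a\to b=b\to a=1$ implies $a=b$. A bounded Hilbert algebra with infimum is an algebra $(H,\wedge,\to,0,1)$ such that $(H,\to,1)$ is a Hilbert algebra, $(H,\wedge)$ is a meet semilattice with greatest element $1$ and least element $0$, and for all $a,b$, $a\le b$ (semilattice order) iff $a\to b=1$. $\mathsf{Hil}_0$ is the category of bounded Hilbert algebras with infimum and algebra homomorphisms. A Kleene poset is a structure $(T,\le,\sim,c)$ such that: (1) $(T,\le)$ is a poset; (2) $\sim$ is a unary operation with $\sim\sim x=x$, and $x\le y$ implies $\sim y\le\sim x$; (3) $c=\sim c$; (4) $x\vee c$ exists for every $x$ (hence $x\wedge c$ exists and equals $\sim(\sim x\vee c)$); (5) for every $x$, $(x\vee c)\wedge(\sim x\vee c)$ exists and equals $c$; (6) for all $x,y$, if $x\wedge c\le y\wedge c$ and $x\vee c\le y\vee c$ then $x\le y$. Here $\wedge,\vee$ denote infima and suprema in $(T,\le)$. The category $\mathsf{KhIS}_0$ has as objects the structures $(T,\le,\sim,\to,c,0,1)$ such that $(T,\le,\sim,c)$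 is a Kleene poset, $0$ is least and $1$ greatest, for all $x,y$ with $x\ge c$ the infimum $x\wedge y$ exists and $(x\wedge y)\vee c=x\wedge(y\vee c)$, and $\to$ is a binary operation on $T$ such that for all $x,y$: (K1) $c\le x\to(y\vee c)$; (K2) $x\wedge((x\vee c)\to(y\vee c))\le y\vee c$; (K3) $x\to x=1$; (K4) $(x\to y)\wedge c=(\sim x\wedge c)\vee(y\wedge c)$; (K5) $(x\to\sim y)\vee c=((x\vee c)\to(\sim y\vee c))\wedge((y\vee c)\to(\sim x\vee c))$. Morphisms of $\mathsf{KhIS}_0$ are maps $g$ preserving the order, $\sim$ and $\to$, and such that $g(x\wedge y)=g(x)\wedge g(y)$ for all $x,y\ge c$. $\mathsf{KHil}_0$ is the full subcategory of $\mathsf{KhIS}_0$ whose objects satisfy, for all $x,y,z$: (KHil1) $(x\vee c)\to(y\to(x\vee c))=1$; (KHil2) $x\to((y\vee c)\to(z\vee c))=(x\to(y\vee c))\to(x\to(z\vee c))$; (KHil3) if $x\to y=y\to x=1$ then $x=y$; (KHil4) $x\wedge((x\vee c)\to(y\vee c))=x\wedge(y\vee c)$; (KHil5) $x\to((y\vee c)\wedge(z\vee c))\le(x\to(y\vee c))\wedge(x\to(z\vee c))$. Condition (CK) for $T$: for all $x,y\ge c$ such that $x\wedge y$ exists and $x\wedge y=c$, there is $z\in T$ with $z\vee c=x$ and $\sim z\vee c=y$. $\mathsf{KHil}_0^{\mathrm{CK}}$ is the full subcategory of $\mathsf{KHil}_0$ of objects satisfying (CK). For $H\in\mathsf{Hil}_0$,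 $\mathrm{K}(H)=\{(a,b)\in H\times H: a\wedge b=0\}$, with order $(a,b)\preceq(d,e)$ iff $a\le d$ and $e\le b$, $\sim(a,b)=(b,a)$, $c=(0,0)$, $0=(0,1)$, $1=(1,0)$, and $(a,b)\to(d,e)=((a\to d)\wedge(e\to b),\,a\wedge e)$. For a morphism $f$, $\mathrm{K}(f)(a,b)=(f(a),f(b))$. For an object $T$ of $\mathsf{KHil}_0$, $\mathrm{C}(T)=\{x\in T:x\ge c\}$ with the restricted operations $\wedge,\to$, least element $c$ and greatest element $1$; for a morphism $g$, $\mathrm{C}(g)$ is the restriction of $g$. The maps are $\alpha_H:H\to\mathrm{C}(\mathrm{K}(H))$, $\alpha_H(a)=(a,0)$, and $\beta_T:T\to\mathrm{K}(\mathrm{C}(T))$, $\beta_T(x)=(x\vee c,\sim x\vee c)$. *)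

theory Defs
  imports "HOL-Algebra.Lattice"
begin

section \<open>Categories, functors, natural isomorphisms, equivalences\<close>

text \<open>Hom-sets are indexed by objects and need not be disjoint; \<open>Comp \<C> X Y Z g f\<close> is
  \<open>g \<circ> f\<close> for \<open>f : X \<rightarrow> Y\<close> and \<open>g : Y \<rightarrow> Z\<close>.\<close>

record ('o, 'm) category =
  Obj :: "'o set"
  Hom :: "'o \<Rightarrow> 'o \<Rightarrow> 'm set"
  Comp :: "'o \<Rightarrow> 'o \<Rightarrow> 'o \<Rightarrow> 'm \<Rightarrow> 'm \<Rightarrow> 'm"
  Ident :: "'o \<Rightarrow> 'm"

locale category =
  fixes \<C> :: "('o, 'm) category"
  assumes ident_in_hom: "X \<in> Obj \<C> \<Longrightarrow> Ident \<C> X \<in> Hom \<C> X X"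
    and comp_in_hom:
      "\<lbrakk>X \<in> Obj \<C>; Y \<in> Obj \<C>; Z \<in> Obj \<C>; f \<in> Hom \<C> X Y; g \<in> Hom \<C> Y Z\<rbrakk>
        \<Longrightarrow> Comp \<C> X Y Z g f \<in> Hom \<C> X Z"
    and comp_ident_left:
      "\<lbrakk>X \<in> Obj \<C>; Y \<in> Obj \<C>; f \<in> Hom \<C> X Y\<rbrakk> \<Longrightarrow> Comp \<C> X Y Y (Ident \<C> Y) f = f"
    and comp_ident_right:
      "\<lbrakk>X \<in> Obj \<C>; Y \<in> Obj \<C>; f \<in> Hom \<C> X Y\<rbrakk> \<Longrightarrow> Comp \<C> X X Y f (Ident \<C> X) = f"
    and comp_assoc:
      "\<lbrakk>W \<in> Obj \<C>; X \<in> Obj \<C>; Y \<in> Obj \<C>; Z \<in> Obj \<C>;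
        f \<in> Hom \<C> W X; g \<in> Hom \<C> X Y; h \<in> Hom \<C> Y Z\<rbrakk>
        \<Longrightarrow> Comp \<C> W Y Z h (Comp \<C> W X Y g f) = Comp \<C> W X Z (Comp \<C> X Y Z h g) f"

definition full_subcategory :: "('o, 'm) category \<Rightarrow> ('o \<Rightarrow> bool) \<Rightarrow> ('o, 'm) category" where
  "full_subcategory \<C> P = \<C>\<lparr>Obj := {X \<in> Obj \<C>. P X}\<rparr>"

definition is_iso :: "('o, 'm) category \<Rightarrow> 'o \<Rightarrow> 'o \<Rightarrow> 'm \<Rightarrow> bool" where
  "is_iso \<C> X Y f \<longleftrightarrow> f \<in> Hom \<C> X Y \<and>
    (\<exists>g \<in> Hom \<C> Y X. Comp \<C> X Y X g f = Ident \<C> X \<and> Comp \<C> Y X Y f g = Ident \<C> Y)"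

text \<open>\<open>amap F X Y\<close> is the action of \<open>F\<close> on arrows \<open>X \<rightarrow> Y\<close>.\<close>

record ('o, 'm, 'p, 'n) functor_data =
  omap :: "'o \<Rightarrow> 'p"
  amap :: "'o \<Rightarrow> 'o \<Rightarrow> 'm \<Rightarrow> 'n"

locale covariant_functor = source: category \<C> + target: category \<D>
  for \<C> :: "('o, 'm) category" and \<D> :: "('p, 'n) category" +
  fixes F :: "('o, 'm, 'p, 'n) functor_data"
  assumes omap_in_obj: "X \<in> Obj \<C> \<Longrightarrow> omap F X \<in> Obj \<D>"
    and amap_in_hom:
      "\<lbrakk>X \<in> Obj \<C>; Y \<in> Obj \<C>; f \<in> Hom \<C> X Y\<rbrakk>
        \<Longrightarrow> amap F X Y f \<in> Hom \<D> (omap F X) (omap F Y)"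
    and amap_ident: "X \<in> Obj \<C> \<Longrightarrow> amap F X X (Ident \<C> X) = Ident \<D> (omap F X)"
    and amap_comp:
      "\<lbrakk>X \<in> Obj \<C>; Y \<in> Obj \<C>; Z \<in> Obj \<C>; f \<in> Hom \<C> X Y; g \<in> Hom \<C> Y Z\<rbrakk>
        \<Longrightarrow> amap F X Z (Comp \<C> X Y Z g f) =
            Comp \<D> (omap F X) (omap F Y) (omap F Z) (amap F Y Z g) (amap F X Y f)"

definition identity_functor :: "('o, 'm, 'o, 'm) functor_data" where
  "identity_functor = \<lparr>omap = (\<lambda>X. X), amap = (\<lambda>X Y f. f)\<rparr>"

definition functor_comp ::
  "('p, 'n, 'q, 'k) functor_data \<Rightarrow> ('o, 'm, 'p, 'n) functor_data \<Rightarrow> ('o, 'm, 'q, 'k) functor_data"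
  where
  "functor_comp G F =
    \<lparr>omap = (\<lambda>X. omap G (omap F X)),
     amap = (\<lambda>X Y f. amap G (omap F X) (omap F Y) (amap F X Y f))\<rparr>"

locale natural_transformation =
  dom: covariant_functor \<C> \<D> F + cod: covariant_functor \<C> \<D> G
  for \<C> :: "('o, 'm) category" and \<D> :: "('p, 'n) category"
    and F G :: "('o, 'm, 'p, 'n) functor_data" +
  fixes \<tau> :: "'o \<Rightarrow> 'n"
  assumes component_in_hom: "X \<in> Obj \<C> \<Longrightarrow> \<tau> X \<in> Hom \<D> (omap F X) (omap G X)"
    and naturality:
      "\<lbrakk>X \<in> Obj \<C>; Y \<in> Obj \<C>; f \<in> Hom \<C> X Y\<rbrakk>
        \<Longrightarrow> Comp \<D> (omap F X) (omap F Y) (omap G Y) (\<tau> Y) (amap F X Y f) =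
            Comp \<D> (omap F X) (omap G X) (omap G Y) (amap G X Y f) (\<tau> X)"

locale natural_isomorphism = natural_transformation +
  assumes component_iso: "X \<in> Obj \<C> \<Longrightarrow> is_iso \<D> (omap F X) (omap G X) (\<tau> X)"

locale category_equivalence =
  F: covariant_functor \<C> \<D> F + G: covariant_functor \<D> \<C> G +
  unit: natural_isomorphism \<C> \<C> identity_functor "functor_comp G F" \<eta> +
  counit: natural_isomorphism \<D> \<D> identity_functor "functor_comp F G" \<epsilon>
  for \<C> :: "('o, 'm) category" and \<D> :: "('p, 'n) category"
    and F :: "('o, 'm, 'p, 'n) functor_data" and G :: "('p, 'n, 'o, 'm) functor_data"
    and \<eta> :: "'o \<Rightarrow> 'm" and \<epsilon> :: "'p \<Rightarrow> 'n"


section \<open>Bounded Hilbert algebras with infimum\<close>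

record 'a hilbert_inf = "'a partial_object" +
  hmeet :: "'a \<Rightarrow> 'a \<Rightarrow> 'a" (infixl \<open>\<^bold>\<and>\<index>\<close> 70)
  himp :: "'a \<Rightarrow> 'a \<Rightarrow> 'a" (infixr \<open>\<leadsto>\<index>\<close> 60)
  hzero :: 'a (\<open>\<zero>\<index>\<close>)
  hone :: 'a (\<open>\<one>\<index>\<close>)

text \<open>The semilattice order.\<close>

definition hle :: "('a, 'b) hilbert_inf_scheme \<Rightarrow> 'a \<Rightarrow> 'a \<Rightarrow> bool" (infix \<open>\<preceq>\<index>\<close> 50) where
  "x \<preceq>\<^bsub>H\<^esub> y \<longleftrightarrow> x \<^bold>\<and>\<^bsub>H\<^esub> y = x"

locale hilbert_algebra =
  fixes H (structure)
  assumes imp_closed: "\<lbrakk>a \<in> carrier H; b \<in> carrier H\<rbrakk> \<Longrightarrow> a \<leadsto> b \<in> carrier H"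
    and one_closed: "\<one> \<in> carrier H"
    and imp_K: "\<lbrakk>a \<in> carrier H; b \<in> carrier H\<rbrakk> \<Longrightarrow> a \<leadsto> (b \<leadsto> a) = \<one>"
    and imp_S: "\<lbrakk>a \<in> carrier H; b \<in> carrier H; d \<in> carrier H\<rbrakk>
      \<Longrightarrow> a \<leadsto> (b \<leadsto> d) = (a \<leadsto> b) \<leadsto> (a \<leadsto> d)"
    and imp_antisym: "\<lbrakk>a \<in> carrier H; b \<in> carrier H; a \<leadsto> b = \<one>; b \<leadsto> a = \<one>\<rbrakk> \<Longrightarrow> a = b"

locale bounded_hilbert_inf = hilbert_algebra H
  for H :: "('a, 'b) hilbert_inf_scheme" (structure) +
  assumes meet_closed: "\<lbrakk>a \<in> carrier H; b \<in> carrier H\<rbrakk> \<Longrightarrow> a \<^bold>\<and> b \<in> carrier H"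
    and meet_assoc: "\<lbrakk>a \<in> carrier H; b \<in> carrier H; d \<in> carrier H\<rbrakk>
      \<Longrightarrow> (a \<^bold>\<and> b) \<^bold>\<and> d = a \<^bold>\<and> (b \<^bold>\<and> d)"
    and meet_comm: "\<lbrakk>a \<in> carrier H; b \<in> carrier H\<rbrakk> \<Longrightarrow> a \<^bold>\<and> b = b \<^bold>\<and> a"
    and meet_idem: "a \<in> carrier H \<Longrightarrow> a \<^bold>\<and> a = a"
    and zero_closed: "\<zero> \<in> carrier H"
    and zero_least: "a \<in> carrier H \<Longrightarrow> \<zero> \<preceq> a"
    and one_greatest: "a \<in> carrier H \<Longrightarrow> a \<preceq> \<one>"
    and le_iff_imp: "\<lbrakk>a \<in> carrier H; b \<in> carrier H\<rbrakk> \<Longrightarrow> a \<preceq> b \<longleftrightarrow> a \<leadsto> b = \<one>"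

text \<open>Morphisms are extensional functions, so that two morphisms are equal as soon as they
  agree on the carrier of the domain.\<close>

definition hil_hom :: "'a hilbert_inf \<Rightarrow> 'a hilbert_inf \<Rightarrow> ('a \<Rightarrow> 'a) set" where
  "hil_hom H H' = {f \<in> carrier H \<rightarrow>\<^sub>E carrier H'.
     (\<forall>a \<in> carrier H. \<forall>b \<in> carrier H. f (a \<^bold>\<and>\<^bsub>H\<^esub> b) = f a \<^bold>\<and>\<^bsub>H'\<^esub> f b) \<and>
     (\<forall>a \<in> carrier H. \<forall>b \<in> carrier H. f (a \<leadsto>\<^bsub>H\<^esub> b) = f a \<leadsto>\<^bsub>H'\<^esub> f b) \<and>
     f \<zero>\<^bsub>H\<^esub> = \<zero>\<^bsub>H'\<^esub> \<and> f \<one>\<^bsub>H\<^esub> = \<one>\<^bsub>H'\<^esub>}"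

definition Hil0 :: "('a hilbert_inf, 'a \<Rightarrow> 'a) category" where
  "Hil0 = \<lparr>Obj = {H. bounded_hilbert_inf H},
           Hom = hil_hom,
           Comp = (\<lambda>H H' H'' g f. compose (carrier H) g f),
           Ident = (\<lambda>H. \<lambda>x \<in> carrier H. x)\<rparr>"


section \<open>Kleene posets with an implication\<close>

record 'a khil = "'a gorder" +
  kneg :: "'a \<Rightarrow> 'a" (\<open>\<sim>\<index> _\<close> [81] 80)
  kimp :: "'a \<Rightarrow> 'a \<Rightarrow> 'a" (infixr \<open>\<hookrightarrow>\<index>\<close> 60)
  kcenter :: 'a (\<open>\<cc>\<index>\<close>)
  kzero :: 'a
  kone :: 'a

text \<open>The operations \<open>\<sqinter>\<close>, \<open>\<squnion>\<close> of the library are unspecified when the infimum or supremum does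
  not exist.\<close>

abbreviation is_inf :: "('a, 'b) gorder_scheme \<Rightarrow> 'a \<Rightarrow> 'a \<Rightarrow> 'a \<Rightarrow> bool" where
  "is_inf T m x y \<equiv> greatest T m (Lower T {x, y})"

abbreviation is_sup :: "('a, 'b) gorder_scheme \<Rightarrow> 'a \<Rightarrow> 'a \<Rightarrow> 'a \<Rightarrow> bool" where
  "is_sup T s x y \<equiv> least T s (Upper T {x, y})"

text \<open>The infima \<open>x \<sqinter> \<cc>\<close> exist by \<open>join_center_exists\<close> and the order-reversing involution.\<close>

locale kleene_poset = partial_order T
  for T :: "('a, 'b) khil_scheme" (structure) +
  assumes neg_closed: "x \<in> carrier T \<Longrightarrow> \<sim> x \<in> carrier T"
    and center_closed: "\<cc> \<in> carrier T"
    and neg_neg: "x \<in> carrier T \<Longrightarrow> \<sim> (\<sim> x) = x"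
    and neg_antitone: "\<lbrakk>x \<in> carrier T; y \<in> carrier T; x \<sqsubseteq> y\<rbrakk> \<Longrightarrow> \<sim> y \<sqsubseteq> \<sim> x"
    and neg_center: "\<cc> = \<sim> \<cc>"
    and join_center_exists: "x \<in> carrier T \<Longrightarrow> \<exists>s. is_sup T s x \<cc>"
    and kleene: "x \<in> carrier T \<Longrightarrow> is_inf T \<cc> (x \<squnion> \<cc>) (\<sim> x \<squnion> \<cc>)"
    and le_by_center: "\<lbrakk>x \<in> carrier T; y \<in> carrier T;
      x \<sqinter> \<cc> \<sqsubseteq> y \<sqinter> \<cc>; x \<squnion> \<cc> \<sqsubseteq> y \<squnion> \<cc>\<rbrakk> \<Longrightarrow> x \<sqsubseteq> y"

text \<open>All infima and suprema below exist: \<open>inf_exists\<close> gives those with one argument above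
  \<open>\<cc>\<close> (note \<open>K1\<close>), and \<open>(\<sim> x \<sqinter> \<cc>) \<squnion> (y \<sqinter> \<cc>)\<close> in \<open>K4\<close> is the \<open>\<sim>\<close>-dual of such an infimum.\<close>

locale khis = kleene_poset T
  for T :: "('a, 'b) khil_scheme" (structure) +
  assumes zero_least: "least T (kzero T) (carrier T)"
    and one_greatest: "greatest T (kone T) (carrier T)"
    and inf_exists: "\<lbrakk>x \<in> carrier T; y \<in> carrier T; \<cc> \<sqsubseteq> x\<rbrakk> \<Longrightarrow> \<exists>m. is_inf T m x y"
    and inf_join_center: "\<lbrakk>x \<in> carrier T; y \<in> carrier T; \<cc> \<sqsubseteq> x\<rbrakk>
      \<Longrightarrow> (x \<sqinter> y) \<squnion> \<cc> = x \<sqinter> (y \<squnion> \<cc>)"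
    and imp_closed: "\<lbrakk>x \<in> carrier T; y \<in> carrier T\<rbrakk> \<Longrightarrow> x \<hookrightarrow> y \<in> carrier T"
    and K1: "\<lbrakk>x \<in> carrier T; y \<in> carrier T\<rbrakk> \<Longrightarrow> \<cc> \<sqsubseteq> (x \<hookrightarrow> (y \<squnion> \<cc>))"
    and K2: "\<lbrakk>x \<in> carrier T; y \<in> carrier T\<rbrakk>
      \<Longrightarrow> x \<sqinter> ((x \<squnion> \<cc>) \<hookrightarrow> (y \<squnion> \<cc>)) \<sqsubseteq> y \<squnion> \<cc>"
    and K3: "x \<in> carrier T \<Longrightarrow> x \<hookrightarrow> x = kone T"
    and K4: "\<lbrakk>x \<in> carrier T; y \<in> carrier T\<rbrakk>
      \<Longrightarrow> (x \<hookrightarrow> y) \<sqinter> \<cc> = (\<sim> x \<sqinter> \<cc>) \<squnion> (y \<sqinter> \<cc>)"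
    and K5: "\<lbrakk>x \<in> carrier T; y \<in> carrier T\<rbrakk>
      \<Longrightarrow> (x \<hookrightarrow> \<sim> y) \<squnion> \<cc> =
          ((x \<squnion> \<cc>) \<hookrightarrow> (\<sim> y \<squnion> \<cc>)) \<sqinter> ((y \<squnion> \<cc>) \<hookrightarrow> (\<sim> x \<squnion> \<cc>))"

text \<open>Such maps preserve \<open>\<cc>\<close>, which is the only fixed point of \<open>\<sim>\<close>, and hence map elements above
  \<open>\<cc>\<close> to elements above \<open>\<cc>\<close>; so the infimum on the right of the last clause exists.\<close>

definition khis_hom :: "'a khil \<Rightarrow> 'a khil \<Rightarrow> ('a \<Rightarrow> 'a) set" where
  "khis_hom T T' = {g \<in> carrier T \<rightarrow>\<^sub>E carrier T'.
     (\<forall>x \<in> carrier T. \<forall>y \<in> carrier T. x \<sqsubseteq>\<^bsub>T\<^esub> y \<longrightarrow> g x \<sqsubseteq>\<^bsub>T'\<^esub> g y) \<and>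
     (\<forall>x \<in> carrier T. g (\<sim>\<^bsub>T\<^esub> x) = \<sim>\<^bsub>T'\<^esub> (g x)) \<and>
     (\<forall>x \<in> carrier T. \<forall>y \<in> carrier T. g (x \<hookrightarrow>\<^bsub>T\<^esub> y) = g x \<hookrightarrow>\<^bsub>T'\<^esub> g y) \<and>
     (\<forall>x \<in> carrier T. \<forall>y \<in> carrier T. \<cc>\<^bsub>T\<^esub> \<sqsubseteq>\<^bsub>T\<^esub> x \<and> \<cc>\<^bsub>T\<^esub> \<sqsubseteq>\<^bsub>T\<^esub> y \<longrightarrow>
        g (x \<sqinter>\<^bsub>T\<^esub> y) = g x \<sqinter>\<^bsub>T'\<^esub> g y)}"

definition KhIS0 :: "('a khil, 'a \<Rightarrow> 'a) category" where
  "KhIS0 = \<lparr>Obj = {T. khis T},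
            Hom = khis_hom,
            Comp = (\<lambda>T T' T'' g f. compose (carrier T) g f),
            Ident = (\<lambda>T. \<lambda>x \<in> carrier T. x)\<rparr>"

locale khil_laws =
  fixes T :: "('a, 'b) khil_scheme" (structure)
  assumes KHil1: "\<lbrakk>x \<in> carrier T; y \<in> carrier T\<rbrakk>
      \<Longrightarrow> (x \<squnion> \<cc>) \<hookrightarrow> (y \<hookrightarrow> (x \<squnion> \<cc>)) = kone T"
    and KHil2: "\<lbrakk>x \<in> carrier T; y \<in> carrier T; z \<in> carrier T\<rbrakk>
      \<Longrightarrow> x \<hookrightarrow> ((y \<squnion> \<cc>) \<hookrightarrow> (z \<squnion> \<cc>)) = (x \<hookrightarrow> (y \<squnion> \<cc>)) \<hookrightarrow> (x \<hookrightarrow> (z \<squnion> \<cc>))"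
    and KHil3: "\<lbrakk>x \<in> carrier T; y \<in> carrier T; x \<hookrightarrow> y = kone T; y \<hookrightarrow> x = kone T\<rbrakk> \<Longrightarrow> x = y"
    and KHil4: "\<lbrakk>x \<in> carrier T; y \<in> carrier T\<rbrakk>
      \<Longrightarrow> x \<sqinter> ((x \<squnion> \<cc>) \<hookrightarrow> (y \<squnion> \<cc>)) = x \<sqinter> (y \<squnion> \<cc>)"
    and KHil5: "\<lbrakk>x \<in> carrier T; y \<in> carrier T; z \<in> carrier T\<rbrakk>
      \<Longrightarrow> (x \<hookrightarrow> ((y \<squnion> \<cc>) \<sqinter> (z \<squnion> \<cc>))) \<sqsubseteq> (x \<hookrightarrow> (y \<squnion> \<cc>)) \<sqinter> (x \<hookrightarrow> (z \<squnion> \<cc>))"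

definition KHil0 :: "('a khil, 'a \<Rightarrow> 'a) category" where
  "KHil0 = full_subcategory KhIS0 khil_laws"

definition CK :: "('a, 'b) khil_scheme \<Rightarrow> bool" where
  "CK T \<longleftrightarrow> (\<forall>x \<in> carrier T. \<forall>y \<in> carrier T.
     \<cc>\<^bsub>T\<^esub> \<sqsubseteq>\<^bsub>T\<^esub> x \<and> \<cc>\<^bsub>T\<^esub> \<sqsubseteq>\<^bsub>T\<^esub> y \<and> is_inf T \<cc>\<^bsub>T\<^esub> x y \<longrightarrow>
     (\<exists>z \<in> carrier T. z \<squnion>\<^bsub>T\<^esub> \<cc>\<^bsub>T\<^esub> = x \<and> \<sim>\<^bsub>T\<^esub> z \<squnion>\<^bsub>T\<^esub> \<cc>\<^bsub>T\<^esub> = y))"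

definition KHil0_CK :: "('a khil, 'a \<Rightarrow> 'a) category" where
  "KHil0_CK = full_subcategory KHil0 CK"


section \<open>The functors and the natural maps\<close>

text \<open>All objects of a category must have carriers in one type, whereas \<open>K(H)\<close> consists of pairs
  of elements of \<open>H\<close>. Hence we work in a universe that contains arbitrary atoms \<open>'a\<close> and is
  closed under ordered pairs. Objects are structures on arbitrary subsets of it, so that, as \<open>'a\<close>
  varies, every structure on any type has an isomorphic copy.\<close>

datatype 'a univ = Atom 'a | UPair (ufst: "'a univ") (usnd: "'a univ")

definition K_obj :: "'a univ hilbert_inf \<Rightarrow> 'a univ khil" where
  "K_obj H =
    \<lparr>carrier = {UPair a b | a b. a \<in> carrier H \<and> b \<in> carrier H \<and> a \<^bold>\<and>\<^bsub>H\<^esub> b = \<zero>\<^bsub>H\<^esub>},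
     eq = (=),
     le = (\<lambda>p q. ufst p \<preceq>\<^bsub>H\<^esub> ufst q \<and> usnd q \<preceq>\<^bsub>H\<^esub> usnd p),
     kneg = (\<lambda>p. UPair (usnd p) (ufst p)),
     kimp = (\<lambda>p q. UPair ((ufst p \<leadsto>\<^bsub>H\<^esub> ufst q) \<^bold>\<and>\<^bsub>H\<^esub> (usnd q \<leadsto>\<^bsub>H\<^esub> usnd p))
                         (ufst p \<^bold>\<and>\<^bsub>H\<^esub> usnd q)),
     kcenter = UPair \<zero>\<^bsub>H\<^esub> \<zero>\<^bsub>H\<^esub>,
     kzero = UPair \<zero>\<^bsub>H\<^esub> \<one>\<^bsub>H\<^esub>,
     kone = UPair \<one>\<^bsub>H\<^esub> \<zero>\<^bsub>H\<^esub>\<rparr>"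

definition K_functor ::
  "('a univ hilbert_inf, 'a univ \<Rightarrow> 'a univ, 'a univ khil, 'a univ \<Rightarrow> 'a univ) functor_data"
  where
  "K_functor =
    \<lparr>omap = K_obj,
     amap = (\<lambda>H H' f. \<lambda>p \<in> carrier (K_obj H). UPair (f (ufst p)) (f (usnd p)))\<rparr>"

definition C_obj :: "'a khil \<Rightarrow> 'a hilbert_inf" where
  "C_obj T =
    \<lparr>carrier = {x \<in> carrier T. \<cc>\<^bsub>T\<^esub> \<sqsubseteq>\<^bsub>T\<^esub> x},
     hmeet = (\<lambda>x y. x \<sqinter>\<^bsub>T\<^esub> y),
     himp = (\<lambda>x y. x \<hookrightarrow>\<^bsub>T\<^esub> y),
     hzero = \<cc>\<^bsub>T\<^esub>,
     hone = kone T\<rparr>"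

definition C_functor :: "('a khil, 'a \<Rightarrow> 'a, 'a hilbert_inf, 'a \<Rightarrow> 'a) functor_data" where
  "C_functor =
    \<lparr>omap = C_obj,
     amap = (\<lambda>T T' g. restrict g (carrier (C_obj T)))\<rparr>"

definition alpha :: "'a univ hilbert_inf \<Rightarrow> 'a univ \<Rightarrow> 'a univ" where
  "alpha H = (\<lambda>a \<in> carrier H. UPair a \<zero>\<^bsub>H\<^esub>)"

definition beta :: "'a univ khil \<Rightarrow> 'a univ \<Rightarrow> 'a univ" where
  "beta T = (\<lambda>x \<in> carrier T. UPair (x \<squnion>\<^bsub>T\<^esub> \<cc>\<^bsub>T\<^esub>) (\<sim>\<^bsub>T\<^esub> x \<squnion>\<^bsub>T\<^esub> \<cc>\<^bsub>T\<^esub>))"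

end

(* In K(H) the join of (a,b) with c is (a,0) and the meet is (0,b), which reduces every law of K(H)
   to the Hilbert algebra H. Conversely le_by_center says that an element x of T is determined,
   order included, by its join with c and the join of its negation with c; so beta embeds the order
   of T, and (CK) is surjectivity. The one delicate point is the naturality of beta: morphisms are
   not assumed to preserve joins with c, and the residuation argument available in Heyting algebras
   has to be replaced; see khis_hom_join_center. *)

theory Submission
  imports Defs
begin

section \<open>Functors\<close>

text \<open>Residuation survives in one direction only: \<open>x \<preceq> a \<leadsto> b\<close>
  puts the meet of \<open>x\<close> and \<open>a\<close> below \<open>b\<close>, but not conversely.
  On the four-element Boolean lattice with \<open>a \<leadsto> b\<close> equal to
  \<open>\<one>\<close> if \<open>a \<preceq> b\<close> and to \<open>b\<close> otherwise, the atoms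
  \<open>p\<close> and \<open>q\<close> are disjoint although
  \<open>p \<leadsto> \<zero> = \<zero>\<close>. So an element \<open>(a, b)\<close> of K(H) need
  not satisfy \<open>b \<preceq> a \<leadsto> \<zero>\<close>, and reasoning about implication goes
  through modus ponens, monotonicity in the second argument and exchange of premises. On the side of
  T, \<open>K4\<close> and \<open>K5\<close> act as coordinate formulas: \<open>K5\<close> gives the
  join of \<open>x \<hookrightarrow> y\<close> with c, \<open>K4\<close> that of its negation, both
  in terms of elements above c. They match the two coordinates of the implication in K(C(T)), which
  is why \<beta> preserves implication.\<close>

lemma covariant_functor_identity:
  assumes "category \<C>"
  shows "covariant_functor \<C> \<C> identity_functor"
  using assms by (auto simp: covariant_functor_def covariant_functor_axioms_def identity_functor_def)

lemma covariant_functor_comp: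
  assumes "covariant_functor \<C> \<D> F" and "covariant_functor \<D> \<E> G"
  shows "covariant_functor \<C> \<E> (functor_comp G F)"
proof -
  interpret F: covariant_functor \<C> \<D> F by fact
  interpret G: covariant_functor \<D> \<E> G by fact
  show ?thesis
    by unfold_locales
      (simp_all add: functor_comp_def F.omap_in_obj G.omap_in_obj F.amap_in_hom G.amap_in_hom
        F.amap_ident G.amap_ident F.amap_comp G.amap_comp)
qed


section \<open>Infima and suprema of two elements\<close>

context partial_order
begin

lemma is_inf_iff:
  assumes "x \<in> carrier L" "y \<in> carrier L"
  shows "is_inf L m x y \<longleftrightarrow> m \<in> carrier L \<and> m \<sqsubseteq> x \<and> m \<sqsubseteq> y \<and>
    (\<forall>z \<in> carrier L. z \<sqsubseteq> x \<longrightarrow> z \<sqsubseteq> y \<longrightarrow> z \<sqsubseteq> m)"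
  using assms by (auto simp: greatest_def Lower_def)

lemma is_sup_iff:
  assumes "x \<in> carrier L" "y \<in> carrier L"
  shows "is_sup L s x y \<longleftrightarrow> s \<in> carrier L \<and> x \<sqsubseteq> s \<and> y \<sqsubseteq> s \<and>
    (\<forall>z \<in> carrier L. x \<sqsubseteq> z \<longrightarrow> y \<sqsubseteq> z \<longrightarrow> s \<sqsubseteq> z)"
  using assms by (auto simp: least_def Upper_def)

text \<open>\<open>\<sqinter>\<close> is a choice among greatest lower bounds: one witness validates
  the choice, and uniqueness identifies the two. Concrete meets are therefore computed below by
  exhibiting a candidate.\<close>

lemma meet_eq:
  assumes "is_inf L m x y"
  shows "x \<sqinter> y = m"
proof -
  have "is_inf L (x \<sqinter> y) x y"
    unfolding meet_def inf_def using assms by (rule someI)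
  then show ?thesis
    using assms greatest_unique by blast
qed

lemma join_eq:
  assumes "is_sup L s x y"
  shows "x \<squnion> y = s"
proof -
  have "is_sup L (x \<squnion> y) x y"
    unfolding join_def sup_def using assms by (rule someI)
  then show ?thesis
    using assms least_unique by blast
qed

end


section \<open>Bounded Hilbert algebras with infimum\<close>

context bounded_hilbert_inf
begin

lemmas closed [simp] = imp_closed one_closed meet_closed zero_closed

lemma hle_refl [simp]: "a \<in> carrier H \<Longrightarrow> a \<preceq> a"
  by (simp add: hle_def meet_idem)

lemma hle_antisym: "\<lbrakk>a \<in> carrier H; b \<in> carrier H; a \<preceq> b; b \<preceq> a\<rbrakk> \<Longrightarrow> a = b"
  by (metis hle_def meet_comm)

lemma hle_trans: "\<lbrakk>a \<in> carrier H; b \<in> carrier H; d \<in> carrier H; a \<preceq> b; b \<preceq> d\<rbrakk> \<Longrightarrow> a \<preceq> d"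
  by (metis hle_def meet_assoc)

lemma hle_meet_iff:
  assumes "a \<in> carrier H" "b \<in> carrier H" "x \<in> carrier H"
  shows "x \<preceq> a \<^bold>\<and> b \<longleftrightarrow> x \<preceq> a \<and> x \<preceq> b"
  using assms unfolding hle_def by (metis meet_assoc meet_comm meet_idem meet_closed)

lemma meet_hle1 [simp]: "\<lbrakk>a \<in> carrier H; b \<in> carrier H\<rbrakk> \<Longrightarrow> a \<^bold>\<and> b \<preceq> a"
  using hle_meet_iff hle_refl meet_closed by blast

lemma meet_hle2 [simp]: "\<lbrakk>a \<in> carrier H; b \<in> carrier H\<rbrakk> \<Longrightarrow> a \<^bold>\<and> b \<preceq> b"
  using hle_meet_iff hle_refl meet_closed by blast

lemma hle_zero_iff [simp]: "a \<in> carrier H \<Longrightarrow> a \<preceq> \<zero> \<longleftrightarrow> a = \<zero>"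
  using hle_antisym zero_least by auto

lemma one_hle_iff [simp]: "a \<in> carrier H \<Longrightarrow> \<one> \<preceq> a \<longleftrightarrow> a = \<one>"
  using hle_antisym one_greatest by auto

lemma meet_zero [simp]: "a \<in> carrier H \<Longrightarrow> \<zero> \<^bold>\<and> a = \<zero>" "a \<in> carrier H \<Longrightarrow> a \<^bold>\<and> \<zero> = \<zero>"
  using zero_least meet_comm unfolding hle_def by auto

lemma meet_one [simp]: "a \<in> carrier H \<Longrightarrow> \<one> \<^bold>\<and> a = a" "a \<in> carrier H \<Longrightarrow> a \<^bold>\<and> \<one> = a"
  using one_greatest meet_comm unfolding hle_def by auto

lemma meet_eq_one_iff:
  assumes "a \<in> carrier H" "b \<in> carrier H"
  shows "a \<^bold>\<and> b = \<one> \<longleftrightarrow> a = \<one> \<and> b = \<one>"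
  using assms by (metis hle_meet_iff one_hle_iff meet_closed one_closed)

lemma imp_refl [simp]: "a \<in> carrier H \<Longrightarrow> a \<leadsto> a = \<one>"
  by (simp flip: le_iff_imp)

lemma zero_imp [simp]: "a \<in> carrier H \<Longrightarrow> \<zero> \<leadsto> a = \<one>"
  using le_iff_imp zero_least by auto

lemma imp_one [simp]: "a \<in> carrier H \<Longrightarrow> a \<leadsto> \<one> = \<one>"
  using le_iff_imp one_greatest by auto

lemma hle_imp: "\<lbrakk>a \<in> carrier H; b \<in> carrier H\<rbrakk> \<Longrightarrow> b \<preceq> a \<leadsto> b"
  by (simp add: le_iff_imp imp_K)

lemma one_imp [simp]:
  assumes a: "a \<in> carrier H"
  shows "\<one> \<leadsto> a = a"
proof (rule hle_antisym)
  \<comment> \<open>This instance of \<open>imp_S\<close> has value \<open>\<one>\<close> on the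
    left and premise \<open>(\<one> \<leadsto> a) \<leadsto> \<one> = \<one>\<close> on the right,
    so only \<open>\<one> \<leadsto> ((\<one> \<leadsto> a) \<leadsto> a) = \<one>\<close> remains;
    the outer \<open>\<one>\<close> can be stripped because nothing else lies above
    \<open>\<one>\<close>.\<close>
  have "(\<one> \<leadsto> a) \<leadsto> (\<one> \<leadsto> a) = ((\<one> \<leadsto> a) \<leadsto> \<one>) \<leadsto> ((\<one> \<leadsto> a) \<leadsto> a)"
    using a by (intro imp_S) auto
  then have "\<one> \<leadsto> ((\<one> \<leadsto> a) \<leadsto> a) = \<one>"
    using a by simp
  then have "\<one> \<preceq> (\<one> \<leadsto> a) \<leadsto> a"
    using a by (subst le_iff_imp) auto
  then have "(\<one> \<leadsto> a) \<leadsto> a = \<one>"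
    using a by simp
  then show "\<one> \<leadsto> a \<preceq> a"
    using a by (simp add: le_iff_imp)
qed (use a in \<open>auto simp: hle_imp\<close>)

text \<open>\<open>imp_S\<close> is modus ponens under a premise \<open>x\<close>: the value
  \<open>\<one>\<close> of \<open>x \<leadsto> (a \<leadsto> b)\<close> equals \<open>(x \<leadsto>
  a) \<leadsto> (x \<leadsto> b) = \<one> \<leadsto> (x \<leadsto> b)\<close>.\<close>

lemma modus_ponens:
  assumes "a \<in> carrier H" "b \<in> carrier H" "x \<in> carrier H" "x \<preceq> a" "x \<preceq> a \<leadsto> b"
  shows "x \<preceq> b"
proof -
  have "x \<leadsto> a = \<one>" "x \<leadsto> (a \<leadsto> b) = \<one>"
    using assms by (simp_all flip: le_iff_imp)
  then have "x \<leadsto> b = \<one>"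
    using assms imp_S[of x a b] by simp
  then show ?thesis
    using assms by (simp add: le_iff_imp)
qed

lemma meet_imp:
  assumes a: "a \<in> carrier H" and b: "b \<in> carrier H"
  shows "a \<^bold>\<and> (a \<leadsto> b) = a \<^bold>\<and> b"
proof (rule hle_antisym)
  have "a \<^bold>\<and> (a \<leadsto> b) \<preceq> b"
    by (rule modus_ponens[of a]) (use a b in auto)
  then show "a \<^bold>\<and> (a \<leadsto> b) \<preceq> a \<^bold>\<and> b"
    using a b by (simp add: hle_meet_iff)
  have "a \<^bold>\<and> b \<preceq> a \<leadsto> b"
    by (rule hle_trans[of _ b]) (use a b in \<open>auto simp: hle_imp\<close>)
  then show "a \<^bold>\<and> b \<preceq> a \<^bold>\<and> (a \<leadsto> b)"
    using a b by (simp add: hle_meet_iff)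
qed (use a b in auto)

lemma imp_mono:
  assumes "a \<in> carrier H" "b \<in> carrier H" "d \<in> carrier H" "b \<preceq> d"
  shows "a \<leadsto> b \<preceq> a \<leadsto> d"
proof -
  have "b \<leadsto> d = \<one>"
    using assms le_iff_imp by simp
  then have "(a \<leadsto> b) \<leadsto> (a \<leadsto> d) = \<one>"
    using assms imp_S[of a b d] by simp
  then show ?thesis
    using assms by (simp add: le_iff_imp)
qed

text \<open>Exchange of premises. With residuation both sides would say that the meet of
  \<open>a\<close> and \<open>b\<close> is below \<open>d\<close>; here \<open>imp_S\<close> turns
  the hypothesis into \<open>(b \<leadsto> a) \<leadsto> (b \<leadsto> d) = \<one>\<close>, and
  \<open>a \<preceq> b \<leadsto> a\<close> supplies the premise for modus ponens.\<close>

lemma hle_imp_swap: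
  assumes "a \<in> carrier H" "b \<in> carrier H" "d \<in> carrier H" "b \<preceq> a \<leadsto> d"
  shows "a \<preceq> b \<leadsto> d"
proof (rule modus_ponens[of "b \<leadsto> a"])
  have "b \<leadsto> (a \<leadsto> d) = \<one>"
    using assms by (simp flip: le_iff_imp)
  then have "(b \<leadsto> a) \<leadsto> (b \<leadsto> d) = \<one>"
    using assms imp_S[of b a d] by simp
  then show "a \<preceq> (b \<leadsto> a) \<leadsto> (b \<leadsto> d)"
    using assms one_greatest by simp
qed (use assms in \<open>auto simp: hle_imp\<close>)

lemma disjoint_antimono:
  assumes "a \<in> carrier H" "b \<in> carrier H" "x \<in> carrier H" "y \<in> carrier H"
    and "a \<^bold>\<and> b = \<zero>" "x \<preceq> a" "y \<preceq> b"
  shows "x \<^bold>\<and> y = \<zero>"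
proof -
  have "x \<^bold>\<and> y \<preceq> a" "x \<^bold>\<and> y \<preceq> b"
    using assms by (metis hle_trans meet_hle1 meet_closed, metis hle_trans meet_hle2 meet_closed)
  then have "x \<^bold>\<and> y \<preceq> a \<^bold>\<and> b"
    using assms(1-4) by (simp add: hle_meet_iff)
  then show ?thesis
    using assms by simp
qed

end

section \<open>The category of bounded Hilbert algebras with infimum\<close>

lemma hil_hom_ident: "bounded_hilbert_inf H \<Longrightarrow> (\<lambda>x \<in> carrier H. x) \<in> hil_hom H H"
  by (simp add: hil_hom_def bounded_hilbert_inf.meet_closed bounded_hilbert_inf.zero_closed
      bounded_hilbert_inf_def hilbert_algebra.imp_closed hilbert_algebra.one_closed)

lemma hil_hom_compose:
  assumes "bounded_hilbert_inf H" and "f \<in> hil_hom H H'" and "g \<in> hil_hom H' H''"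
  shows "compose (carrier H) g f \<in> hil_hom H H''"
proof -
  interpret bounded_hilbert_inf H by fact
  show ?thesis
    using assms(2,3)
    by (auto simp: hil_hom_def compose_eq PiE_iff Pi_iff extensional_def compose_def)
qed

lemma Hil0_sel [simp]:
  "Obj Hil0 = {H. bounded_hilbert_inf H}"
  "Hom Hil0 = hil_hom"
  "Comp Hil0 = (\<lambda>H H' H'' g f. compose (carrier H) g f)"
  "Ident Hil0 = (\<lambda>H. \<lambda>x \<in> carrier H. x)"
  by (simp_all add: Hil0_def)

lemma category_Hil0: "category (Hil0 :: ('a hilbert_inf, 'a \<Rightarrow> 'a) category)"
proof
  fix X :: "'a hilbert_inf" assume "X \<in> Obj Hil0"
  then show "Ident Hil0 X \<in> Hom Hil0 X X"
    by (simp add: hil_hom_ident)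
next
  fix X Y Z :: "'a hilbert_inf" and f g
  assume "X \<in> Obj Hil0" "f \<in> Hom Hil0 X Y" "g \<in> Hom Hil0 Y Z"
  then show "Comp Hil0 X Y Z g f \<in> Hom Hil0 X Z"
    by (simp add: hil_hom_compose)
next
  fix X Y :: "'a hilbert_inf" and f
  assume "f \<in> Hom Hil0 X Y"
  then show "Comp Hil0 X Y Y (Ident Hil0 Y) f = f" "Comp Hil0 X X Y f (Ident Hil0 X) = f"
    by (auto simp: hil_hom_def PiE_iff intro!: Id_compose compose_Id)
next
  fix W X Y Z :: "'a hilbert_inf" and f g h
  assume "f \<in> Hom Hil0 W X"
  then have "f \<in> carrier W \<rightarrow> carrier X"
    by (auto simp: hil_hom_def)
  then show "Comp Hil0 W Y Z h (Comp Hil0 W X Y g f) = Comp Hil0 W X Z (Comp Hil0 X Y Z h g) f"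
    by (simp add: compose_assoc)
qed

lemma is_iso_Hil0I:
  assumes "bounded_hilbert_inf H" and "bounded_hilbert_inf H'"
    and f: "f \<in> hil_hom H H'" and bij: "bij_betw f (carrier H) (carrier H')"
  shows "is_iso Hil0 H H' f"
proof -
  interpret H: bounded_hilbert_inf H by fact
  interpret H': bounded_hilbert_inf H' by fact
  \<comment> \<open>Restriction makes the inverse extensional, as membership in
    \<open>hil_hom\<close> demands.\<close>
  define g where "g = restrict (inv_into (carrier H) f) (carrier H')"
  have fg: "f (g y) = y" "g y \<in> carrier H" if "y \<in> carrier H'" for y
    using that bij by (auto simp: g_def bij_betw_def f_inv_into_f inv_into_into)
  have gf: "g (f x) = x" "f x \<in> carrier H'" if "x \<in> carrier H" for x
    using that bij by (auto simp: g_def bij_betw_def)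
  have hom: "f (a \<^bold>\<and>\<^bsub>H\<^esub> b) = f a \<^bold>\<and>\<^bsub>H'\<^esub> f b" "f (a \<leadsto>\<^bsub>H\<^esub> b) = f a \<leadsto>\<^bsub>H'\<^esub> f b"
    if "a \<in> carrier H" "b \<in> carrier H" for a b
    using that f by (auto simp: hil_hom_def)
  have bounds: "f \<zero>\<^bsub>H\<^esub> = \<zero>\<^bsub>H'\<^esub>" "f \<one>\<^bsub>H\<^esub> = \<one>\<^bsub>H'\<^esub>"
    using f by (auto simp: hil_hom_def)
  have "g \<in> hil_hom H' H"
    unfolding hil_hom_def
  proof (intro CollectI conjI ballI)
    show "g \<in> carrier H' \<rightarrow>\<^sub>E carrier H"
      using fg by (auto simp: g_def)
    show "g \<zero>\<^bsub>H'\<^esub> = \<zero>\<^bsub>H\<^esub>" "g \<one>\<^bsub>H'\<^esub> = \<one>\<^bsub>H\<^esub>"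
      using gf(1) bounds by (metis H.zero_closed, metis H.one_closed)
    fix a b assume "a \<in> carrier H'" "b \<in> carrier H'"
    then show "g (a \<^bold>\<and>\<^bsub>H'\<^esub> b) = g a \<^bold>\<and>\<^bsub>H\<^esub> g b" "g (a \<leadsto>\<^bsub>H'\<^esub> b) = g a \<leadsto>\<^bsub>H\<^esub> g b"
      using fg gf(1) hom by (metis H.meet_closed, metis H.imp_closed)
  qed
  moreover have "compose (carrier H) g f = (\<lambda>x \<in> carrier H. x)"
    "compose (carrier H') f g = (\<lambda>x \<in> carrier H'. x)"
    using fg gf by (auto simp: compose_def)
  ultimately show ?thesis
    using f by (auto simp: is_iso_def)
qed


section \<open>Kleene posets with an implication\<close>

context kleene_poset
begin

lemmas closed [simp] = neg_closed center_closed

lemma join_center_is_sup: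
  assumes "x \<in> carrier T"
  shows "is_sup T (x \<squnion> \<cc>) x \<cc>"
  using join_center_exists[OF assms] join_eq by metis

lemma join_center [simp]:
  assumes "x \<in> carrier T"
  shows "x \<squnion> \<cc> \<in> carrier T" "x \<sqsubseteq> x \<squnion> \<cc>" "\<cc> \<sqsubseteq> x \<squnion> \<cc>"
  using join_center_is_sup[OF assms] assms by (auto simp: is_sup_iff)

lemma join_center_least:
  assumes "x \<in> carrier T" "z \<in> carrier T" "x \<sqsubseteq> z" "\<cc> \<sqsubseteq> z"
  shows "x \<squnion> \<cc> \<sqsubseteq> z"
  using join_center_is_sup[OF assms(1)] assms by (auto simp: is_sup_iff)

lemma join_center_absorb [simp]: "\<lbrakk>x \<in> carrier T; \<cc> \<sqsubseteq> x\<rbrakk> \<Longrightarrow> x \<squnion> \<cc> = x"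
  by (rule join_eq) (auto simp: is_sup_iff)

lemma join_center_mono: "\<lbrakk>x \<in> carrier T; y \<in> carrier T; x \<sqsubseteq> y\<rbrakk> \<Longrightarrow> x \<squnion> \<cc> \<sqsubseteq> y \<squnion> \<cc>"
  by (meson join_center join_center_least le_trans center_closed)

lemma neg_le_iff: "\<lbrakk>x \<in> carrier T; y \<in> carrier T\<rbrakk> \<Longrightarrow> \<sim> x \<sqsubseteq> \<sim> y \<longleftrightarrow> y \<sqsubseteq> x"
  by (metis neg_antitone neg_closed neg_neg)

lemma neg_le_swap: "\<lbrakk>x \<in> carrier T; y \<in> carrier T\<rbrakk> \<Longrightarrow> \<sim> x \<sqsubseteq> y \<longleftrightarrow> \<sim> y \<sqsubseteq> x"
  by (metis neg_antitone neg_closed neg_neg)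

lemma le_neg_swap: "\<lbrakk>x \<in> carrier T; y \<in> carrier T\<rbrakk> \<Longrightarrow> x \<sqsubseteq> \<sim> y \<longleftrightarrow> y \<sqsubseteq> \<sim> x"
  by (metis neg_antitone neg_closed neg_neg)

lemma is_inf_neg:
  assumes "x \<in> carrier T" "y \<in> carrier T" "is_sup T s x y"
  shows "is_inf T (\<sim> s) (\<sim> x) (\<sim> y)"
  using assms by (simp add: is_inf_iff is_sup_iff neg_antitone) (meson le_neg_swap neg_closed)

lemma is_sup_neg:
  assumes "x \<in> carrier T" "y \<in> carrier T" "is_inf T m x y"
  shows "is_sup T (\<sim> m) (\<sim> x) (\<sim> y)"
  using assms by (simp add: is_inf_iff is_sup_iff neg_antitone) (meson neg_le_swap neg_closed)

lemma meet_center: "x \<in> carrier T \<Longrightarrow> x \<sqinter> \<cc> = \<sim> (\<sim> x \<squnion> \<cc>)"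
  using is_inf_neg[of "\<sim> x" \<cc> "\<sim> x \<squnion> \<cc>"] join_center_is_sup[of "\<sim> x"]
  by (intro meet_eq) (simp add: neg_neg flip: neg_center)

lemma le_iff_joins:
  assumes x: "x \<in> carrier T" and y: "y \<in> carrier T"
  shows "x \<sqsubseteq> y \<longleftrightarrow> x \<squnion> \<cc> \<sqsubseteq> y \<squnion> \<cc> \<and> \<sim> y \<squnion> \<cc> \<sqsubseteq> \<sim> x \<squnion> \<cc>"
  using x y le_by_center[of x y]
  by (auto simp: meet_center neg_le_iff join_center_mono)

text \<open>At a fixed point the two elements in \<open>kleene\<close> coincide, so their infimum c
  is \<open>x \<squnion> \<cc>\<close> itself; this puts \<open>x\<close> below c, and negation puts
  it above. It is the source of the preservation of c by morphisms.\<close>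

lemma neg_fixpoint:
  assumes "x \<in> carrier T" "\<sim> x = x"
  shows "x = \<cc>"
proof -
  have "z \<sqsubseteq> \<cc>" if "z \<in> carrier T" "z \<sqsubseteq> x \<squnion> \<cc>" "z \<sqsubseteq> \<sim> x \<squnion> \<cc>" for z
    using kleene[of x] assms(1) that by (simp add: is_inf_iff)
  then have "x \<squnion> \<cc> \<sqsubseteq> \<cc>"
    using assms by simp
  then have "x \<sqsubseteq> \<cc>"
    using assms by (meson join_center le_trans center_closed)
  moreover have "\<cc> \<sqsubseteq> x"
    using neg_le_iff[of \<cc> x] \<open>x \<sqsubseteq> \<cc>\<close> assms by (simp flip: neg_center)
  ultimately show ?thesis
    using assms by (simp add: le_antisym)
qed

end

context khis
begin

lemma one [simp]:
  shows "kone T \<in> carrier T" "x \<in> carrier T \<Longrightarrow> x \<sqsubseteq> kone T"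
  using one_greatest by (auto simp: greatest_def)

lemma is_inf_meet:
  assumes "x \<in> carrier T" "y \<in> carrier T" "\<cc> \<sqsubseteq> x"
  shows "is_inf T (x \<sqinter> y) x y"
  using inf_exists[OF assms] meet_eq by metis

lemma meet_above [simp]:
  assumes "x \<in> carrier T" "y \<in> carrier T" "\<cc> \<sqsubseteq> x"
  shows "x \<sqinter> y \<in> carrier T" "x \<sqinter> y \<sqsubseteq> x" "x \<sqinter> y \<sqsubseteq> y"
  using is_inf_meet[OF assms] assms by (auto simp: is_inf_iff)

lemma le_meet_iff:
  assumes "x \<in> carrier T" "y \<in> carrier T" "\<cc> \<sqsubseteq> x" "z \<in> carrier T"
  shows "z \<sqsubseteq> x \<sqinter> y \<longleftrightarrow> z \<sqsubseteq> x \<and> z \<sqsubseteq> y"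
proof
  assume "z \<sqsubseteq> x \<sqinter> y"
  then show "z \<sqsubseteq> x \<and> z \<sqsubseteq> y"
    using assms by (meson le_trans meet_above)
qed (use is_inf_meet[OF assms(1-3)] assms in \<open>auto simp: is_inf_iff\<close>)

lemma imp_above: "\<lbrakk>x \<in> carrier T; y \<in> carrier T; \<cc> \<sqsubseteq> y\<rbrakk> \<Longrightarrow> \<cc> \<sqsubseteq> x \<hookrightarrow> y"
  using K1[of x y] by simp

text \<open>\<open>K4\<close> in dual form: the join of two elements below c is the negation of the
  meet of their negations, which exists because these lie above c. The right-hand side is the second
  coordinate of the implication of pairs.\<close>

lemma neg_imp_join_center:
  assumes x: "x \<in> carrier T" and y: "y \<in> carrier T"
  shows "\<sim> (x \<hookrightarrow> y) \<squnion> \<cc> = (x \<squnion> \<cc>) \<sqinter> (\<sim> y \<squnion> \<cc>)"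
proof -
  let ?m = "(x \<squnion> \<cc>) \<sqinter> (\<sim> y \<squnion> \<cc>)"
  have "is_sup T (\<sim> ?m) (\<sim> x \<sqinter> \<cc>) (y \<sqinter> \<cc>)"
    using x y is_sup_neg[OF _ _ is_inf_meet] by (simp add: meet_center neg_neg)
  then have "(x \<hookrightarrow> y) \<sqinter> \<cc> = \<sim> ?m"
    using K4[OF x y] join_eq by simp
  then have "\<sim> (\<sim> (x \<hookrightarrow> y) \<squnion> \<cc>) = \<sim> ?m"
    using x y by (simp add: meet_center imp_closed)
  then show ?thesis
    using x y by (metis join_center(1,3) imp_closed meet_above(1) neg_closed neg_neg)
qed

end

lemma (in khis) meet_eq_left_iff:
  assumes "x \<in> carrier T" "y \<in> carrier T" "\<cc> \<sqsubseteq> x"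
  shows "x \<sqinter> y = x \<longleftrightarrow> x \<sqsubseteq> y"
proof
  assume "x \<sqsubseteq> y"
  then have "x \<sqsubseteq> x \<sqinter> y"
    using assms by (simp add: le_meet_iff)
  then show "x \<sqinter> y = x"
    using assms by (simp add: le_antisym)
qed (use assms meet_above(3)[OF assms] in simp)

text \<open>\<open>K5\<close> read at \<open>\<sim> y\<close>: the first coordinate of the
  implication of pairs.\<close>

lemma (in khis) imp_join_center:
  assumes "x \<in> carrier T" "y \<in> carrier T"
  shows "(x \<hookrightarrow> y) \<squnion> \<cc> = ((x \<squnion> \<cc>) \<hookrightarrow> (y \<squnion> \<cc>)) \<sqinter> ((\<sim> y \<squnion> \<cc>) \<hookrightarrow> (\<sim> x \<squnion> \<cc>))"
  using K5[of x "\<sim> y"] assms by (simp add: neg_neg)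

lemma (in khis) neg_one: "\<sim> (kone T) = kzero T"
proof (rule le_antisym)
  show "\<sim> (kone T) \<sqsubseteq> kzero T"
    using zero_least by (subst neg_le_swap) (auto simp: least_def)
qed (use zero_least in \<open>auto simp: least_def\<close>)

section \<open>Morphisms of Kleene posets with implication, and their category\<close>

lemma khis_hom_center:
  assumes "kleene_poset T" and "kleene_poset T'" and "g \<in> khis_hom T T'"
  shows "g \<cc>\<^bsub>T\<^esub> = \<cc>\<^bsub>T'\<^esub>"
proof -
  interpret T: kleene_poset T by fact
  interpret T': kleene_poset T' by fact
  have "g \<cc>\<^bsub>T\<^esub> \<in> carrier T'" "\<sim>\<^bsub>T'\<^esub> (g \<cc>\<^bsub>T\<^esub>) = g (\<sim>\<^bsub>T\<^esub> \<cc>\<^bsub>T\<^esub>)"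
    using assms(3) by (auto simp: khis_hom_def)
  then show ?thesis
    by (intro T'.neg_fixpoint) (simp_all flip: T.neg_center)
qed

text \<open>By \<open>K3\<close> the greatest element is
  \<open>\<cc> \<hookrightarrow> \<cc>\<close>, built from data that morphisms preserve.\<close>

lemma khis_hom_one:
  assumes "khis T" and "khis T'" and g: "g \<in> khis_hom T T'"
  shows "g (kone T) = kone T'"
proof -
  interpret T: khis T by fact
  interpret T': khis T' by fact
  have c: "g \<cc>\<^bsub>T\<^esub> = \<cc>\<^bsub>T'\<^esub>"
    using g by (intro khis_hom_center) unfold_locales
  have "g (\<cc>\<^bsub>T\<^esub> \<hookrightarrow>\<^bsub>T\<^esub> \<cc>\<^bsub>T\<^esub>) = g \<cc>\<^bsub>T\<^esub> \<hookrightarrow>\<^bsub>T'\<^esub> g \<cc>\<^bsub>T\<^esub>"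
    using g by (auto simp: khis_hom_def)
  then show ?thesis
    by (simp add: c T.K3 T'.K3)
qed

lemma khis_hom_ident: "khis T \<Longrightarrow> (\<lambda>x \<in> carrier T. x) \<in> khis_hom T T"
proof -
  assume "khis T"
  then interpret khis T .
  show ?thesis
    by (simp add: khis_hom_def imp_closed)
qed

lemma khis_hom_compose:
  assumes "khis T" and "khis T'" and f: "f \<in> khis_hom T T'" and g: "g \<in> khis_hom T' T''"
  shows "compose (carrier T) g f \<in> khis_hom T T''"
proof -
  interpret T: khis T by fact
  interpret T': khis T' by fact
  have c: "f \<cc>\<^bsub>T\<^esub> = \<cc>\<^bsub>T'\<^esub>"
    using f by (intro khis_hom_center) unfold_locales
  have cl: "f x \<in> carrier T'" if "x \<in> carrier T" for x
    using f that by (auto simp: khis_hom_def)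
  \<comment> \<open>The meet clause for \<open>g\<close> speaks only of arguments above c, so
    \<open>f\<close> must keep elements above c.\<close>
  have above: "\<cc>\<^bsub>T'\<^esub> \<sqsubseteq>\<^bsub>T'\<^esub> f x" if "x \<in> carrier T" "\<cc>\<^bsub>T\<^esub> \<sqsubseteq>\<^bsub>T\<^esub> x" for x
    using f that unfolding c[symmetric] by (auto simp: khis_hom_def)
  show ?thesis
    using f g cl above
    by (auto simp: khis_hom_def compose_eq T.imp_closed PiE_iff Pi_iff extensional_def compose_def)
qed

lemma KHil0_CK_sel [simp]:
  "Obj KHil0_CK = {T. khis T \<and> khil_laws T \<and> CK T}"
  "Hom KHil0_CK = khis_hom"
  "Comp KHil0_CK = (\<lambda>T T' T'' g f. compose (carrier T) g f)"
  "Ident KHil0_CK = (\<lambda>T. \<lambda>x \<in> carrier T. x)"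
  by (auto simp: KHil0_CK_def KHil0_def KhIS0_def full_subcategory_def)

lemma category_KHil0_CK: "category (KHil0_CK :: ('a khil, 'a \<Rightarrow> 'a) category)"
proof
  fix X :: "'a khil" assume "X \<in> Obj KHil0_CK"
  then show "Ident KHil0_CK X \<in> Hom KHil0_CK X X"
    by (simp add: khis_hom_ident)
next
  fix X Y Z :: "'a khil" and f g
  assume "X \<in> Obj KHil0_CK" "Y \<in> Obj KHil0_CK" "f \<in> Hom KHil0_CK X Y" "g \<in> Hom KHil0_CK Y Z"
  then show "Comp KHil0_CK X Y Z g f \<in> Hom KHil0_CK X Z"
    by (auto intro: khis_hom_compose)
next
  fix X Y :: "'a khil" and f
  assume "f \<in> Hom KHil0_CK X Y"
  then show "Comp KHil0_CK X Y Y (Ident KHil0_CK Y) f = f"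
    "Comp KHil0_CK X X Y f (Ident KHil0_CK X) = f"
    by (auto simp: khis_hom_def PiE_iff intro!: Id_compose compose_Id)
next
  fix W X Y Z :: "'a khil" and f g h
  assume "f \<in> Hom KHil0_CK W X"
  then have "f \<in> carrier W \<rightarrow> carrier X"
    by (auto simp: khis_hom_def)
  then show "Comp KHil0_CK W Y Z h (Comp KHil0_CK W X Y g f) =
      Comp KHil0_CK W X Z (Comp KHil0_CK X Y Z h g) f"
    by (simp add: compose_assoc)
qed

text \<open>An order isomorphism transports the existing infima, so the last clause of
  \<open>khis_hom_def\<close> comes for free.\<close>

lemma khis_hom_if_order_iso:
  assumes "khis T" and "khis T'"
    and ext: "f \<in> extensional (carrier T)" and bij: "bij_betw f (carrier T) (carrier T')"
    and le: "\<And>x y. \<lbrakk>x \<in> carrier T; y \<in> carrier T\<rbrakk> \<Longrightarrow> f x \<sqsubseteq>\<^bsub>T'\<^esub> f y \<longleftrightarrow> x \<sqsubseteq>\<^bsub>T\<^esub> y"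
    and neg: "\<And>x. x \<in> carrier T \<Longrightarrow> f (\<sim>\<^bsub>T\<^esub> x) = \<sim>\<^bsub>T'\<^esub> (f x)"
    and imp: "\<And>x y. \<lbrakk>x \<in> carrier T; y \<in> carrier T\<rbrakk> \<Longrightarrow> f (x \<hookrightarrow>\<^bsub>T\<^esub> y) = f x \<hookrightarrow>\<^bsub>T'\<^esub> f y"
  shows "f \<in> khis_hom T T'"
proof -
  interpret T: khis T by fact
  interpret T': khis T' by fact
  have im: "f ` carrier T = carrier T'"
    using bij by (simp add: bij_betw_def)
  have "f (x \<sqinter>\<^bsub>T\<^esub> y) = f x \<sqinter>\<^bsub>T'\<^esub> f y"
    if "x \<in> carrier T" "y \<in> carrier T" "\<cc>\<^bsub>T\<^esub> \<sqsubseteq>\<^bsub>T\<^esub> x" for x y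
  proof -
    have "is_inf T' (f (x \<sqinter>\<^bsub>T\<^esub> y)) (f x) (f y)"
      using that im by (auto simp: T'.is_inf_iff le T.le_meet_iff simp flip: im)
    then show ?thesis
      using T'.meet_eq by metis
  qed
  then show ?thesis
    using ext im by (auto simp: khis_hom_def le neg imp PiE_iff)
qed

text \<open>The order hypothesis is an equivalence so that it passes to the inverse map, making that
  map monotone as well; the laws for negation and implication pass to it by bijectivity.\<close>

lemma is_iso_KHil0_CKI:
  assumes "khis T" and "khis T'"
    and ext: "f \<in> extensional (carrier T)" and bij: "bij_betw f (carrier T) (carrier T')"
    and le: "\<And>x y. \<lbrakk>x \<in> carrier T; y \<in> carrier T\<rbrakk> \<Longrightarrow> f x \<sqsubseteq>\<^bsub>T'\<^esub> f y \<longleftrightarrow> x \<sqsubseteq>\<^bsub>T\<^esub> y"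
    and neg: "\<And>x. x \<in> carrier T \<Longrightarrow> f (\<sim>\<^bsub>T\<^esub> x) = \<sim>\<^bsub>T'\<^esub> (f x)"
    and imp: "\<And>x y. \<lbrakk>x \<in> carrier T; y \<in> carrier T\<rbrakk> \<Longrightarrow> f (x \<hookrightarrow>\<^bsub>T\<^esub> y) = f x \<hookrightarrow>\<^bsub>T'\<^esub> f y"
  shows "is_iso KHil0_CK T T' f"
proof -
  interpret T: khis T by fact
  interpret T': khis T' by fact
  define g where "g = restrict (inv_into (carrier T) f) (carrier T')"
  have fg: "f (g y) = y" "g y \<in> carrier T" if "y \<in> carrier T'" for y
    using that bij by (auto simp: g_def bij_betw_def f_inv_into_f inv_into_into)
  have gf: "g (f x) = x" "f x \<in> carrier T'" if "x \<in> carrier T" for x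
    using that bij by (auto simp: g_def bij_betw_def)
  have "f \<in> khis_hom T T'"
    using assms by (rule khis_hom_if_order_iso)
  moreover have "g \<in> khis_hom T' T"
  proof (rule khis_hom_if_order_iso)
    show "bij_betw g (carrier T') (carrier T)"
      using fg gf by (intro bij_betw_byWitness[where f' = f]) auto
  next
    fix x y assume xy: "x \<in> carrier T'" "y \<in> carrier T'"
    then show "g x \<sqsubseteq>\<^bsub>T\<^esub> g y \<longleftrightarrow> x \<sqsubseteq>\<^bsub>T'\<^esub> y"
      using le fg by metis
    show "g (x \<hookrightarrow>\<^bsub>T'\<^esub> y) = g x \<hookrightarrow>\<^bsub>T\<^esub> g y"
      using xy imp fg gf T.imp_closed by metis
    show "g (\<sim>\<^bsub>T'\<^esub> x) = \<sim>\<^bsub>T\<^esub> (g x)"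
      using xy neg fg gf T.neg_closed by metis
  qed (use assms in \<open>auto simp: g_def\<close>)
  moreover have "compose (carrier T) g f = (\<lambda>x \<in> carrier T. x)"
    "compose (carrier T') f g = (\<lambda>x \<in> carrier T'. x)"
    using fg gf by (auto simp: compose_def)
  ultimately show ?thesis
    by (auto simp: is_iso_def)
qed


section \<open>The functor K\<close>

text \<open>Fixing the element type to \<open>'a univ\<close> makes pairs of elements of
  \<open>H\<close> inhabit the same type, so that \<open>K_obj H\<close> is defined.\<close>

locale hilbert_univ = bounded_hilbert_inf H for H :: "'a univ hilbert_inf" (structure)
begin

lemma K_obj_sel [simp]:
  "UPair a b \<in> carrier (K_obj H) \<longleftrightarrow> a \<in> carrier H \<and> b \<in> carrier H \<and> a \<^bold>\<and> b = \<zero>"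
  "UPair a b \<sqsubseteq>\<^bsub>K_obj H\<^esub> UPair d e \<longleftrightarrow> a \<preceq> d \<and> e \<preceq> b"
  "eq (K_obj H) = (=)"
  "\<sim>\<^bsub>K_obj H\<^esub> (UPair a b) = UPair b a"
  "UPair a b \<hookrightarrow>\<^bsub>K_obj H\<^esub> UPair d e = UPair ((a \<leadsto> d) \<^bold>\<and> (e \<leadsto> b)) (a \<^bold>\<and> e)"
  "\<cc>\<^bsub>K_obj H\<^esub> = UPair \<zero> \<zero>"
  "kzero (K_obj H) = UPair \<zero> \<one>"
  "kone (K_obj H) = UPair \<one> \<zero>"
  by (simp_all add: K_obj_def)

lemma K_objE:
  assumes "p \<in> carrier (K_obj H)"
  obtains a b where "p = UPair a b" "a \<in> carrier H" "b \<in> carrier H" "a \<^bold>\<and> b = \<zero>"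
  using assms by (auto simp: K_obj_def)

sublocale K: partial_order "K_obj H"
  by unfold_locales (auto elim!: K_objE intro: hle_antisym hle_trans)

lemma K_is_sup_center:
  assumes "a \<in> carrier H" "b \<in> carrier H" "a \<^bold>\<and> b = \<zero>"
  shows "is_sup (K_obj H) (UPair a \<zero>) (UPair a b) (UPair \<zero> \<zero>)"
  using assms by (auto simp: K.is_sup_iff zero_least elim!: K_objE)

text \<open>A meet of pairs is a meet in the first coordinate and a join in the second.
  \<open>H\<close> need not have joins, but a join with \<open>\<zero>\<close> always exists; hence
  the second pair has the form \<open>(d, 0)\<close>.\<close>

lemma K_is_inf:
  assumes "a \<in> carrier H" "b \<in> carrier H" "d \<in> carrier H" "a \<^bold>\<and> b = \<zero>"
  shows "is_inf (K_obj H) (UPair (a \<^bold>\<and> d) b) (UPair a b) (UPair d \<zero>)"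
proof -
  have "(a \<^bold>\<and> d) \<^bold>\<and> b = \<zero>"
    using disjoint_antimono[of a b "a \<^bold>\<and> d" b] assms by simp
  then show ?thesis
    using assms by (auto simp: K.is_inf_iff hle_meet_iff zero_least elim!: K_objE)
qed

lemma K_is_inf':
  assumes "a \<in> carrier H" "b \<in> carrier H" "d \<in> carrier H" "a \<^bold>\<and> b = \<zero>"
  shows "is_inf (K_obj H) (UPair (d \<^bold>\<and> a) b) (UPair d \<zero>) (UPair a b)"
  using K_is_inf[OF assms] assms by (simp add: insert_commute meet_comm)

lemma K_lattice_simps [simp]:
  "\<lbrakk>a \<in> carrier H; b \<in> carrier H; a \<^bold>\<and> b = \<zero>\<rbrakk>
    \<Longrightarrow> UPair a b \<squnion>\<^bsub>K_obj H\<^esub> UPair \<zero> \<zero> = UPair a \<zero>"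
  "\<lbrakk>a \<in> carrier H; b \<in> carrier H; d \<in> carrier H; a \<^bold>\<and> b = \<zero>\<rbrakk>
    \<Longrightarrow> UPair a b \<sqinter>\<^bsub>K_obj H\<^esub> UPair d \<zero> = UPair (a \<^bold>\<and> d) b"
  "\<lbrakk>a \<in> carrier H; b \<in> carrier H; d \<in> carrier H; a \<^bold>\<and> b = \<zero>\<rbrakk>
    \<Longrightarrow> UPair d \<zero> \<sqinter>\<^bsub>K_obj H\<^esub> UPair a b = UPair (d \<^bold>\<and> a) b"
  by (auto intro: K.join_eq K_is_sup_center K.meet_eq K_is_inf K_is_inf')

text \<open>Computes the join on the right-hand side of \<open>K4\<close>, where both arguments are
  meets with c.\<close>

lemma K_join_below_center [simp]:
  assumes "a \<in> carrier H" "b \<in> carrier H"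
  shows "UPair \<zero> a \<squnion>\<^bsub>K_obj H\<^esub> UPair \<zero> b = UPair \<zero> (a \<^bold>\<and> b)"
  using assms by (intro K.join_eq) (auto simp: K.is_sup_iff hle_meet_iff zero_least elim!: K_objE)

lemma kleene_poset_K_obj: "kleene_poset (K_obj H)"
proof unfold_locales
  fix x assume "x \<in> carrier (K_obj H)"
  then show "\<exists>s. is_sup (K_obj H) s x \<cc>\<^bsub>K_obj H\<^esub>"
    by (elim K_objE) (auto intro: K_is_sup_center)
next
  fix x assume "x \<in> carrier (K_obj H)"
  then show "is_inf (K_obj H) \<cc>\<^bsub>K_obj H\<^esub> (x \<squnion>\<^bsub>K_obj H\<^esub> \<cc>\<^bsub>K_obj H\<^esub>)
      (\<sim>\<^bsub>K_obj H\<^esub> x \<squnion>\<^bsub>K_obj H\<^esub> \<cc>\<^bsub>K_obj H\<^esub>)"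
  proof (elim K_objE)
    fix a b assume ab: "x = UPair a b" "a \<in> carrier H" "b \<in> carrier H" "a \<^bold>\<and> b = \<zero>"
    then have "b \<^bold>\<and> a = \<zero>"
      by (simp add: meet_comm)
    with ab show ?thesis
      using K_is_inf[of a \<zero> b] by simp
  qed
qed (auto simp: meet_comm elim!: K_objE)

text \<open>An element below all four factors is below \<open>e\<close> and
  \<open>e \<leadsto> b\<close>, hence below \<open>b\<close>, and also below \<open>a\<close>; but
  \<open>a\<close> and \<open>b\<close> are disjoint. This keeps the implication of two pairs inside
  K(H).\<close>

lemma K_imp_disjoint:
  assumes "a \<in> carrier H" "b \<in> carrier H" "a \<^bold>\<and> b = \<zero>"
    and "d \<in> carrier H" "e \<in> carrier H"
  shows "((a \<leadsto> d) \<^bold>\<and> (e \<leadsto> b)) \<^bold>\<and> (a \<^bold>\<and> e) = \<zero>"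
proof -
  let ?x = "((a \<leadsto> d) \<^bold>\<and> (e \<leadsto> b)) \<^bold>\<and> (a \<^bold>\<and> e)"
  have cl: "?x \<in> carrier H"
    using assms by simp
  have "?x \<preceq> ?x"
    using cl by simp
  then have "?x \<preceq> e \<leadsto> b" "?x \<preceq> a" "?x \<preceq> e"
    using assms cl by (simp_all add: hle_meet_iff del: hle_refl)
  moreover from this have "?x \<preceq> b"
    using assms cl modus_ponens by blast
  ultimately have "?x \<preceq> a \<^bold>\<and> b"
    using assms(1,2) cl by (simp add: hle_meet_iff)
  then show ?thesis
    using assms(3) cl by simp
qed

lemma khis_K_obj: "khis (K_obj H)"
proof -
  interpret K: kleene_poset "K_obj H"
    by (rule kleene_poset_K_obj)
  show ?thesis
  proof unfold_locales
    show "least (K_obj H) (kzero (K_obj H)) (carrier (K_obj H))"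
      "greatest (K_obj H) (kone (K_obj H)) (carrier (K_obj H))"
      by (auto simp: least_def greatest_def zero_least one_greatest elim!: K_objE)
  next
    fix x y assume "x \<in> carrier (K_obj H)" "y \<in> carrier (K_obj H)"
    then obtain a b d e where x: "x = UPair a b" "a \<in> carrier H" "b \<in> carrier H" "a \<^bold>\<and> b = \<zero>"
      and y: "y = UPair d e" "d \<in> carrier H" "e \<in> carrier H" "d \<^bold>\<and> e = \<zero>"
      by (elim K_objE)
    have comm: "b \<^bold>\<and> a = \<zero>" "e \<^bold>\<and> d = \<zero>"
      using x y by (simp_all add: meet_comm)
    note xy = x y comm
    show "x \<hookrightarrow>\<^bsub>K_obj H\<^esub> y \<in> carrier (K_obj H)"
      using xy by (simp add: K_imp_disjoint)
    show "x \<hookrightarrow>\<^bsub>K_obj H\<^esub> x = kone (K_obj H)"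
      using xy by simp
    show "\<cc>\<^bsub>K_obj H\<^esub> \<sqsubseteq>\<^bsub>K_obj H\<^esub> x \<hookrightarrow>\<^bsub>K_obj H\<^esub> (y \<squnion>\<^bsub>K_obj H\<^esub> \<cc>\<^bsub>K_obj H\<^esub>)"
      using xy by (simp add: zero_least)
    show "x \<sqinter>\<^bsub>K_obj H\<^esub> ((x \<squnion>\<^bsub>K_obj H\<^esub> \<cc>\<^bsub>K_obj H\<^esub>) \<hookrightarrow>\<^bsub>K_obj H\<^esub> (y \<squnion>\<^bsub>K_obj H\<^esub> \<cc>\<^bsub>K_obj H\<^esub>))
        \<sqsubseteq>\<^bsub>K_obj H\<^esub> y \<squnion>\<^bsub>K_obj H\<^esub> \<cc>\<^bsub>K_obj H\<^esub>"
      using xy by (simp add: zero_least meet_imp)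
    show "(x \<hookrightarrow>\<^bsub>K_obj H\<^esub> y) \<sqinter>\<^bsub>K_obj H\<^esub> \<cc>\<^bsub>K_obj H\<^esub> =
        (\<sim>\<^bsub>K_obj H\<^esub> x \<sqinter>\<^bsub>K_obj H\<^esub> \<cc>\<^bsub>K_obj H\<^esub>) \<squnion>\<^bsub>K_obj H\<^esub> (y \<sqinter>\<^bsub>K_obj H\<^esub> \<cc>\<^bsub>K_obj H\<^esub>)"
      using xy by (simp add: K_imp_disjoint)
    show "(x \<hookrightarrow>\<^bsub>K_obj H\<^esub> \<sim>\<^bsub>K_obj H\<^esub> y) \<squnion>\<^bsub>K_obj H\<^esub> \<cc>\<^bsub>K_obj H\<^esub> =
        ((x \<squnion>\<^bsub>K_obj H\<^esub> \<cc>\<^bsub>K_obj H\<^esub>) \<hookrightarrow>\<^bsub>K_obj H\<^esub> (\<sim>\<^bsub>K_obj H\<^esub> y \<squnion>\<^bsub>K_obj H\<^esub> \<cc>\<^bsub>K_obj H\<^esub>)) \<sqinter>\<^bsub>K_obj H\<^esub>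
        ((y \<squnion>\<^bsub>K_obj H\<^esub> \<cc>\<^bsub>K_obj H\<^esub>) \<hookrightarrow>\<^bsub>K_obj H\<^esub> (\<sim>\<^bsub>K_obj H\<^esub> x \<squnion>\<^bsub>K_obj H\<^esub> \<cc>\<^bsub>K_obj H\<^esub>))"
      using xy by (simp add: K_imp_disjoint)
    assume "\<cc>\<^bsub>K_obj H\<^esub> \<sqsubseteq>\<^bsub>K_obj H\<^esub> x"
    \<comment> \<open>Thus \<open>x\<close> is \<open>(a, 0)\<close>, exactly the case in which the
      infimum with \<open>y\<close> needs no join in \<open>H\<close>.\<close>
    then have "b = \<zero>"
      using xy by simp
    then show "\<exists>m. is_inf (K_obj H) m x y"
      "(x \<sqinter>\<^bsub>K_obj H\<^esub> y) \<squnion>\<^bsub>K_obj H\<^esub> \<cc>\<^bsub>K_obj H\<^esub> = x \<sqinter>\<^bsub>K_obj H\<^esub> (y \<squnion>\<^bsub>K_obj H\<^esub> \<cc>\<^bsub>K_obj H\<^esub>)"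
      using xy K_is_inf'[of d e a] disjoint_antimono[of d e "a \<^bold>\<and> d" e] by auto
  qed
qed

lemma khil_laws_K_obj: "khil_laws (K_obj H)"
proof
  fix x y assume "x \<in> carrier (K_obj H)" "y \<in> carrier (K_obj H)"
  then obtain a b d e where x: "x = UPair a b" "a \<in> carrier H" "b \<in> carrier H" "a \<^bold>\<and> b = \<zero>"
    and y: "y = UPair d e" "d \<in> carrier H" "e \<in> carrier H" "d \<^bold>\<and> e = \<zero>"
    by (elim K_objE)
  show "(x \<squnion>\<^bsub>K_obj H\<^esub> \<cc>\<^bsub>K_obj H\<^esub>) \<hookrightarrow>\<^bsub>K_obj H\<^esub> y \<hookrightarrow>\<^bsub>K_obj H\<^esub> (x \<squnion>\<^bsub>K_obj H\<^esub> \<cc>\<^bsub>K_obj H\<^esub>) =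
      kone (K_obj H)"
    using x y by (simp add: imp_K)
  show "x \<sqinter>\<^bsub>K_obj H\<^esub> ((x \<squnion>\<^bsub>K_obj H\<^esub> \<cc>\<^bsub>K_obj H\<^esub>) \<hookrightarrow>\<^bsub>K_obj H\<^esub> (y \<squnion>\<^bsub>K_obj H\<^esub> \<cc>\<^bsub>K_obj H\<^esub>)) =
      x \<sqinter>\<^bsub>K_obj H\<^esub> (y \<squnion>\<^bsub>K_obj H\<^esub> \<cc>\<^bsub>K_obj H\<^esub>)"
    using x y by (simp add: meet_imp)
  assume "x \<hookrightarrow>\<^bsub>K_obj H\<^esub> y = kone (K_obj H)" "y \<hookrightarrow>\<^bsub>K_obj H\<^esub> x = kone (K_obj H)"
  \<comment> \<open>An implication equal to \<open>(1, 0)\<close> has both factors of its first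
    coordinate equal to \<open>\<one>\<close>; the two directions together give antisymmetry of
    implication in each coordinate separately.\<close>
  then show "x = y"
    using x y imp_antisym by (simp add: meet_eq_one_iff)
next
  fix x y z
  assume "x \<in> carrier (K_obj H)" "y \<in> carrier (K_obj H)" "z \<in> carrier (K_obj H)"
  then obtain a b d e u v where x: "x = UPair a b" "a \<in> carrier H" "b \<in> carrier H" "a \<^bold>\<and> b = \<zero>"
    and y: "y = UPair d e" "d \<in> carrier H" "e \<in> carrier H" "d \<^bold>\<and> e = \<zero>"
    and z: "z = UPair u v" "u \<in> carrier H" "v \<in> carrier H" "u \<^bold>\<and> v = \<zero>"
    by (elim K_objE)
  show "x \<hookrightarrow>\<^bsub>K_obj H\<^esub> (y \<squnion>\<^bsub>K_obj H\<^esub> \<cc>\<^bsub>K_obj H\<^esub>) \<hookrightarrow>\<^bsub>K_obj H\<^esub> (z \<squnion>\<^bsub>K_obj H\<^esub> \<cc>\<^bsub>K_obj H\<^esub>) =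
      (x \<hookrightarrow>\<^bsub>K_obj H\<^esub> (y \<squnion>\<^bsub>K_obj H\<^esub> \<cc>\<^bsub>K_obj H\<^esub>)) \<hookrightarrow>\<^bsub>K_obj H\<^esub> (x \<hookrightarrow>\<^bsub>K_obj H\<^esub> (z \<squnion>\<^bsub>K_obj H\<^esub> \<cc>\<^bsub>K_obj H\<^esub>))"
    using x y z by (simp add: imp_S[of a d u])
  show "x \<hookrightarrow>\<^bsub>K_obj H\<^esub> ((y \<squnion>\<^bsub>K_obj H\<^esub> \<cc>\<^bsub>K_obj H\<^esub>) \<sqinter>\<^bsub>K_obj H\<^esub> (z \<squnion>\<^bsub>K_obj H\<^esub> \<cc>\<^bsub>K_obj H\<^esub>))
      \<sqsubseteq>\<^bsub>K_obj H\<^esub> (x \<hookrightarrow>\<^bsub>K_obj H\<^esub> (y \<squnion>\<^bsub>K_obj H\<^esub> \<cc>\<^bsub>K_obj H\<^esub>)) \<sqinter>\<^bsub>K_obj H\<^esub> (x \<hookrightarrow>\<^bsub>K_obj H\<^esub> (z \<squnion>\<^bsub>K_obj H\<^esub> \<cc>\<^bsub>K_obj H\<^esub>))"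
    using x y z by (simp add: hle_meet_iff imp_mono)
qed

text \<open>Elements above c are \<open>(a, 0)\<close> and \<open>(b, 0)\<close>; if they meet in c,
  then \<open>a\<close> and \<open>b\<close> are disjoint, so \<open>(a, b)\<close> itself is an
  element of K(H) and has them as its coordinates.\<close>

lemma CK_K_obj: "CK (K_obj H)"
  unfolding CK_def
proof (intro ballI impI)
  fix x y assume "x \<in> carrier (K_obj H)" "y \<in> carrier (K_obj H)"
    and *: "\<cc>\<^bsub>K_obj H\<^esub> \<sqsubseteq>\<^bsub>K_obj H\<^esub> x \<and> \<cc>\<^bsub>K_obj H\<^esub> \<sqsubseteq>\<^bsub>K_obj H\<^esub> y \<and> is_inf (K_obj H) \<cc>\<^bsub>K_obj H\<^esub> x y"
  then obtain a b where x: "x = UPair a \<zero>" "a \<in> carrier H" and y: "y = UPair b \<zero>" "b \<in> carrier H"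
    by (auto elim!: K_objE)
  have "x \<sqinter>\<^bsub>K_obj H\<^esub> y = \<cc>\<^bsub>K_obj H\<^esub>"
    using * K.meet_eq by blast
  then have "a \<^bold>\<and> b = \<zero>" "b \<^bold>\<and> a = \<zero>"
    using x y by (simp_all add: meet_comm)
  then show "\<exists>z \<in> carrier (K_obj H). z \<squnion>\<^bsub>K_obj H\<^esub> \<cc>\<^bsub>K_obj H\<^esub> = x \<and>
      \<sim>\<^bsub>K_obj H\<^esub> z \<squnion>\<^bsub>K_obj H\<^esub> \<cc>\<^bsub>K_obj H\<^esub> = y"
    using x y by (intro bexI[of _ "UPair a b"]) auto
qed

end

section \<open>The action of K on arrows\<close>

lemma K_arrow_in_khis_hom:
  fixes H H' :: "'a univ hilbert_inf"
  assumes "bounded_hilbert_inf H" and "bounded_hilbert_inf H'" and f: "f \<in> hil_hom H H'"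
  shows "(\<lambda>p \<in> carrier (K_obj H). UPair (f (ufst p)) (f (usnd p))) \<in> khis_hom (K_obj H) (K_obj H')"
    (is "?g \<in> _")
proof -
  interpret H: hilbert_univ H by (intro hilbert_univ.intro) fact
  interpret H': hilbert_univ H' by (intro hilbert_univ.intro) fact
  interpret KH: khis "K_obj H" by (rule H.khis_K_obj)
  have f_closed: "f a \<in> carrier H'" if "a \<in> carrier H" for a
    using f that by (auto simp: hil_hom_def)
  have f_meet: "f (a \<^bold>\<and>\<^bsub>H\<^esub> b) = f a \<^bold>\<and>\<^bsub>H'\<^esub> f b" and f_imp: "f (a \<leadsto>\<^bsub>H\<^esub> b) = f a \<leadsto>\<^bsub>H'\<^esub> f b"
    if "a \<in> carrier H" "b \<in> carrier H" for a b
    using f that by (auto simp: hil_hom_def)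
  have f_zero: "f \<zero>\<^bsub>H\<^esub> = \<zero>\<^bsub>H'\<^esub>"
    using f by (auto simp: hil_hom_def)
  have f_mono: "f a \<preceq>\<^bsub>H'\<^esub> f b" if "a \<in> carrier H" "b \<in> carrier H" "a \<preceq>\<^bsub>H\<^esub> b" for a b
    using that by (simp add: hle_def flip: f_meet)
  have g: "?g (UPair a b) = UPair (f a) (f b)" "f a \<^bold>\<and>\<^bsub>H'\<^esub> f b = \<zero>\<^bsub>H'\<^esub>"
    if "a \<in> carrier H" "b \<in> carrier H" "a \<^bold>\<and>\<^bsub>H\<^esub> b = \<zero>\<^bsub>H\<^esub>" for a b
    using that by (simp_all add: f_zero flip: f_meet)
  show ?thesis
    unfolding khis_hom_def
  proof (intro CollectI conjI ballI impI)
    show "?g \<in> carrier (K_obj H) \<rightarrow>\<^sub>E carrier (K_obj H')"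
      by (auto elim!: H.K_objE simp: f_closed g(2))
  next
    fix x assume "x \<in> carrier (K_obj H)"
    then show "?g (\<sim>\<^bsub>K_obj H\<^esub> x) = \<sim>\<^bsub>K_obj H'\<^esub> (?g x)"
      by (auto elim!: H.K_objE simp: H.meet_comm)
  next
    fix x y assume xy: "x \<in> carrier (K_obj H)" "y \<in> carrier (K_obj H)"
    then show "?g (x \<hookrightarrow>\<^bsub>K_obj H\<^esub> y) = ?g x \<hookrightarrow>\<^bsub>K_obj H'\<^esub> ?g y"
      using KH.imp_closed[OF xy] by (auto elim!: H.K_objE simp: f_meet f_imp)
    show "?g x \<sqsubseteq>\<^bsub>K_obj H'\<^esub> ?g y" if "x \<sqsubseteq>\<^bsub>K_obj H\<^esub> y"
      using xy that by (auto elim!: H.K_objE simp: f_mono)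
    show "?g (x \<sqinter>\<^bsub>K_obj H\<^esub> y) = ?g x \<sqinter>\<^bsub>K_obj H'\<^esub> ?g y"
      if "\<cc>\<^bsub>K_obj H\<^esub> \<sqsubseteq>\<^bsub>K_obj H\<^esub> x \<and> \<cc>\<^bsub>K_obj H\<^esub> \<sqsubseteq>\<^bsub>K_obj H\<^esub> y"
      using xy that by (auto elim!: H.K_objE simp: f_meet f_closed f_zero)
  qed
qed

lemma covariant_functor_K: "covariant_functor Hil0 KHil0_CK K_functor"
proof (intro covariant_functor.intro covariant_functor_axioms.intro category_Hil0 category_KHil0_CK)
  fix X :: "'a univ hilbert_inf" assume "X \<in> Obj Hil0"
  then interpret hilbert_univ X by (simp add: hilbert_univ_def)
  show "omap K_functor X \<in> Obj KHil0_CK"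
    by (simp add: K_functor_def khis_K_obj khil_laws_K_obj CK_K_obj)
  show "amap K_functor X X (Ident Hil0 X) = Ident KHil0_CK (omap K_functor X)"
    by (auto simp: K_functor_def intro!: restrict_ext elim!: K_objE)
next
  fix X Y :: "'a univ hilbert_inf" and f
  assume "X \<in> Obj Hil0" "Y \<in> Obj Hil0" "f \<in> Hom Hil0 X Y"
  then show "amap K_functor X Y f \<in> Hom KHil0_CK (omap K_functor X) (omap K_functor Y)"
    using K_arrow_in_khis_hom by (simp add: K_functor_def)
next
  fix X Y Z :: "'a univ hilbert_inf" and f g
  assume X: "X \<in> Obj Hil0" and Y: "Y \<in> Obj Hil0" and f: "f \<in> Hom Hil0 X Y"
  interpret hilbert_univ X using X by (simp add: hilbert_univ_def)
  \<comment> \<open>The actions on arrows are restricted to carriers, so the composite unfolds only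
    once the intermediate pair is known to lie in K(Y).\<close>
  have "UPair (f a) (f b) \<in> carrier (K_obj Y)"
    if "a \<in> carrier X" "b \<in> carrier X" "a \<^bold>\<and>\<^bsub>X\<^esub> b = \<zero>\<^bsub>X\<^esub>" for a b
  proof -
    have "amap K_functor X Y f \<in> carrier (K_obj X) \<rightarrow>\<^sub>E carrier (K_obj Y)"
      using K_arrow_in_khis_hom[of X Y f] X Y f by (simp add: K_functor_def khis_hom_def)
    then have "amap K_functor X Y f (UPair a b) \<in> carrier (K_obj Y)"
      by (rule PiE_mem) (use that in simp)
    then show ?thesis
      using that by (simp add: K_functor_def)
  qed
  then show "amap K_functor X Z (Comp Hil0 X Y Z g f) =
      Comp KHil0_CK (omap K_functor X) (omap K_functor Y) (omap K_functor Z)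
        (amap K_functor Y Z g) (amap K_functor X Y f)"
    by (auto simp: K_functor_def compose_def intro!: restrict_ext elim!: K_objE)
qed


section \<open>The functor C\<close>

lemma C_obj_sel [simp]:
  "x \<in> carrier (C_obj T) \<longleftrightarrow> x \<in> carrier T \<and> \<cc>\<^bsub>T\<^esub> \<sqsubseteq>\<^bsub>T\<^esub> x"
  "x \<^bold>\<and>\<^bsub>C_obj T\<^esub> y = x \<sqinter>\<^bsub>T\<^esub> y"
  "x \<leadsto>\<^bsub>C_obj T\<^esub> y = x \<hookrightarrow>\<^bsub>T\<^esub> y"
  "\<zero>\<^bsub>C_obj T\<^esub> = \<cc>\<^bsub>T\<^esub>"
  "\<one>\<^bsub>C_obj T\<^esub> = kone T"
  by (simp_all add: C_obj_def)

lemma hle_C_obj_iff: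
  assumes "khis T" "x \<in> carrier (C_obj T)" "y \<in> carrier (C_obj T)"
  shows "x \<preceq>\<^bsub>C_obj T\<^esub> y \<longleftrightarrow> x \<sqsubseteq>\<^bsub>T\<^esub> y"
  using assms khis.meet_eq_left_iff[of T x y] by (simp add: hle_def)

text \<open>On elements above c the joins with c vanish, and \<open>KHil1\<close> to
  \<open>KHil3\<close> become the Hilbert axioms. The link between order and implication takes one
  direction from \<open>KHil5\<close> and the other from \<open>KHil4\<close>.\<close>

lemma bounded_hilbert_inf_C_obj:
  fixes T :: "'a khil" (structure)
  assumes "khis T" and "khil_laws T"
  shows "bounded_hilbert_inf (C_obj T)"
proof -
  interpret khis T by fact
  interpret khil_laws T by fact
  note le_C = hle_C_obj_iff[OF \<open>khis T\<close>]
  show ?thesis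
  proof
    fix a b assume ab: "a \<in> carrier (C_obj T)" "b \<in> carrier (C_obj T)"
    then show "a \<leadsto>\<^bsub>C_obj T\<^esub> b \<in> carrier (C_obj T)"
      by (simp add: imp_closed imp_above)
    show "a \<leadsto>\<^bsub>C_obj T\<^esub> b \<leadsto>\<^bsub>C_obj T\<^esub> a = \<one>\<^bsub>C_obj T\<^esub>"
      using KHil1[of a b] ab by simp
    show "a = b" if "a \<leadsto>\<^bsub>C_obj T\<^esub> b = \<one>\<^bsub>C_obj T\<^esub>" "b \<leadsto>\<^bsub>C_obj T\<^esub> a = \<one>\<^bsub>C_obj T\<^esub>"
      using KHil3[of a b] ab that by simp
    show "a \<^bold>\<and>\<^bsub>C_obj T\<^esub> b \<in> carrier (C_obj T)"
      using ab by (simp add: le_meet_iff)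
    show "a \<^bold>\<and>\<^bsub>C_obj T\<^esub> b = b \<^bold>\<and>\<^bsub>C_obj T\<^esub> a"
      by (simp add: meet_def insert_commute)
    show "a \<^bold>\<and>\<^bsub>C_obj T\<^esub> a = a" "\<zero>\<^bsub>C_obj T\<^esub> \<preceq>\<^bsub>C_obj T\<^esub> a" "a \<preceq>\<^bsub>C_obj T\<^esub> \<one>\<^bsub>C_obj T\<^esub>"
      using ab by (simp_all add: le_C meet_eq_left_iff)
    have "a \<sqsubseteq> b \<longleftrightarrow> a \<hookrightarrow> b = kone T"
    proof
      assume "a \<sqsubseteq> b"
      then have "a \<sqinter> b = a"
        using ab by (simp add: meet_eq_left_iff)
      \<comment> \<open>\<open>KHil5\<close> with first conjunct \<open>a\<close> bounds
        \<open>a \<hookrightarrow> (a \<sqinter> b)\<close>, which is now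
        \<open>a \<hookrightarrow> a\<close>, by a meet containing
        \<open>a \<hookrightarrow> b\<close>.\<close>
      then have "kone T \<sqsubseteq> kone T \<sqinter> (a \<hookrightarrow> b)"
        using KHil5[of a a b] ab by (simp add: K3)
      then have "kone T \<sqsubseteq> a \<hookrightarrow> b"
        using ab by (simp add: le_meet_iff imp_closed)
      then show "a \<hookrightarrow> b = kone T"
        using ab by (simp add: le_antisym imp_closed)
    next
      assume "a \<hookrightarrow> b = kone T"
      then have "a \<sqinter> kone T = a \<sqinter> b"
        using KHil4[of a b] ab by simp
      moreover have "a \<sqinter> kone T = a"
        using ab by (simp add: meet_eq_left_iff)
      ultimately have "a \<sqinter> b = a"
        by simp
      then show "a \<sqsubseteq> b"
        using ab by (simp add: meet_eq_left_iff)
    qed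
    then show "a \<preceq>\<^bsub>C_obj T\<^esub> b \<longleftrightarrow> a \<leadsto>\<^bsub>C_obj T\<^esub> b = \<one>\<^bsub>C_obj T\<^esub>"
      using ab le_C by simp
  next
    fix a b d assume abd: "a \<in> carrier (C_obj T)" "b \<in> carrier (C_obj T)" "d \<in> carrier (C_obj T)"
    then show "a \<leadsto>\<^bsub>C_obj T\<^esub> b \<leadsto>\<^bsub>C_obj T\<^esub> d =
        (a \<leadsto>\<^bsub>C_obj T\<^esub> b) \<leadsto>\<^bsub>C_obj T\<^esub> a \<leadsto>\<^bsub>C_obj T\<^esub> d"
      using KHil2[of a b d] by simp
    show "(a \<^bold>\<and>\<^bsub>C_obj T\<^esub> b) \<^bold>\<and>\<^bsub>C_obj T\<^esub> d = a \<^bold>\<and>\<^bsub>C_obj T\<^esub> (b \<^bold>\<and>\<^bsub>C_obj T\<^esub> d)"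
      unfolding C_obj_sel
    proof (rule meet_eq)
      let ?m = "a \<sqinter> (b \<sqinter> d)"
      have cl: "?m \<in> carrier T"
        using abd by (simp add: le_meet_iff)
      have "?m \<sqsubseteq> a" "?m \<sqsubseteq> b \<sqinter> d"
        using abd by simp_all
      then have "?m \<sqsubseteq> a" "?m \<sqsubseteq> b" "?m \<sqsubseteq> d"
        using abd cl le_meet_iff[of b d ?m] by auto
      then show "is_inf T ?m (a \<sqinter> b) d"
        using abd cl by (simp add: is_inf_iff le_meet_iff del: meet_above(2,3))
    qed
  qed (simp_all)
qed

lemma C_arrow:
  assumes "khis T" and "khis T'" and g: "g \<in> khis_hom T T'"
  shows "restrict g (carrier (C_obj T)) \<in> hil_hom (C_obj T) (C_obj T')"
    and "x \<in> carrier (C_obj T) \<Longrightarrow> g x \<in> carrier (C_obj T')"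
proof -
  interpret T: khis T by fact
  interpret T': khis T' by fact
  have c: "g \<cc>\<^bsub>T\<^esub> = \<cc>\<^bsub>T'\<^esub>"
    using g by (intro khis_hom_center) unfold_locales
  have one: "g (kone T) = kone T'"
    using assms by (rule khis_hom_one)
  have in_C: "g x \<in> carrier (C_obj T')" if "x \<in> carrier (C_obj T)" for x
    using g that by (auto simp: khis_hom_def simp flip: c)
  then show "x \<in> carrier (C_obj T) \<Longrightarrow> g x \<in> carrier (C_obj T')" .
  show "restrict g (carrier (C_obj T)) \<in> hil_hom (C_obj T) (C_obj T')"
    using g in_C one c
    by (auto simp: hil_hom_def khis_hom_def T.imp_closed T.imp_above T.le_meet_iff)
qed

lemma covariant_functor_C:
  "covariant_functor (KHil0_CK :: ('a khil, 'a \<Rightarrow> 'a) category) Hil0 C_functor"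
proof (intro covariant_functor.intro covariant_functor_axioms.intro category_Hil0 category_KHil0_CK)
  fix X :: "'a khil" assume "X \<in> Obj KHil0_CK"
  then show "omap C_functor X \<in> Obj Hil0"
    by (simp add: C_functor_def bounded_hilbert_inf_C_obj)
  show "amap C_functor X X (Ident KHil0_CK X) = Ident Hil0 (omap C_functor X)"
    by (auto simp: C_functor_def)
next
  fix X Y :: "'a khil" and f
  assume "X \<in> Obj KHil0_CK" "Y \<in> Obj KHil0_CK" "f \<in> Hom KHil0_CK X Y"
  then show "amap C_functor X Y f \<in> Hom Hil0 (omap C_functor X) (omap C_functor Y)"
    by (auto simp: C_functor_def intro: C_arrow)
next
  fix X Y Z :: "'a khil" and f g
  assume "X \<in> Obj KHil0_CK" "Y \<in> Obj KHil0_CK" "f \<in> Hom KHil0_CK X Y"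
  then have "f x \<in> carrier (C_obj Y)" if "x \<in> carrier (C_obj X)" for x
    using that C_arrow(2)[of X Y f] by simp
  then show "amap C_functor X Z (Comp KHil0_CK X Y Z g f) =
      Comp Hil0 (omap C_functor X) (omap C_functor Y) (omap C_functor Z)
        (amap C_functor Y Z g) (amap C_functor X Y f)"
    by (auto simp: C_functor_def compose_def)
qed


section \<open>The natural isomorphisms\<close>

lemma is_iso_alpha:
  assumes "bounded_hilbert_inf H"
  shows "is_iso Hil0 H (C_obj (K_obj H)) (alpha H)"
proof -
  interpret hilbert_univ H by (intro hilbert_univ.intro) fact
  have cl: "alpha H a \<in> carrier (C_obj (K_obj H))" if "a \<in> carrier H" for a
    using that by (simp add: alpha_def zero_least)
  show ?thesis
  proof (rule is_iso_Hil0I)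
    show "bounded_hilbert_inf (C_obj (K_obj H))"
      by (intro bounded_hilbert_inf_C_obj khis_K_obj khil_laws_K_obj)
    show "alpha H \<in> hil_hom H (C_obj (K_obj H))"
      using cl by (auto simp: hil_hom_def alpha_def)
    \<comment> \<open>An element of K(H) above c has second coordinate \<open>\<zero>\<close>, so
      the first projection inverts \<alpha>.\<close>
    show "bij_betw (alpha H) (carrier H) (carrier (C_obj (K_obj H)))"
      using cl by (intro bij_betw_byWitness[where f' = ufst]) (auto simp: alpha_def elim!: K_objE)
  qed fact
qed

lemma natural_isomorphism_alpha:
  "natural_isomorphism Hil0 Hil0 identity_functor (functor_comp C_functor K_functor) alpha"
proof (intro natural_isomorphism.intro natural_isomorphism_axioms.intro
    natural_transformation.intro natural_transformation_axioms.intro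
    covariant_functor_identity category_Hil0
    covariant_functor_comp[OF covariant_functor_K covariant_functor_C])
  fix X :: "'a univ hilbert_inf" assume "X \<in> Obj Hil0"
  then show "is_iso Hil0 (omap identity_functor X) (omap (functor_comp C_functor K_functor) X) (alpha X)"
    by (simp add: identity_functor_def functor_comp_def C_functor_def K_functor_def is_iso_alpha)
  then show "alpha X \<in> Hom Hil0 (omap identity_functor X) (omap (functor_comp C_functor K_functor) X)"
    unfolding is_iso_def by blast
next
  fix X Y :: "'a univ hilbert_inf" and f
  assume X: "X \<in> Obj Hil0" and f: "f \<in> Hom Hil0 X Y"
  interpret hilbert_univ X using X by (simp add: hilbert_univ_def)
  show "Comp Hil0 (omap identity_functor X) (omap identity_functor Y)
      (omap (functor_comp C_functor K_functor) Y) (alpha Y) (amap identity_functor X Y f) =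
    Comp Hil0 (omap identity_functor X) (omap (functor_comp C_functor K_functor) X)
      (omap (functor_comp C_functor K_functor) Y)
      (amap (functor_comp C_functor K_functor) X Y f) (alpha X)"
    using f
    by (auto simp: identity_functor_def functor_comp_def C_functor_def K_functor_def
        compose_def alpha_def hil_hom_def zero_least intro!: restrict_ext)
qed

text \<open>Since \<open>\<sim> x\<close> lies below c, its join with c is c, and the second factor
  no longer depends on \<open>x\<close>. Implications into one \<open>y\<close> from different
  elements above c can thus be compared through the first factor alone.\<close>

lemma (in khis) imp_join_center_of_above:
  assumes "khil_laws T" "x \<in> carrier T" "y \<in> carrier T" "\<cc> \<sqsubseteq> x"
  shows "(x \<hookrightarrow> y) \<squnion> \<cc> = (x \<hookrightarrow> (y \<squnion> \<cc>)) \<sqinter> ((\<sim> y \<squnion> \<cc>) \<hookrightarrow> \<cc>)"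
proof -
  have "\<sim> x \<sqsubseteq> \<cc>"
    using assms neg_antitone[of \<cc> x] by (simp flip: neg_center)
  then have "\<sim> x \<squnion> \<cc> = \<cc>"
    using assms by (intro join_eq) (auto simp: is_sup_iff)
  then show ?thesis
    using imp_join_center[of x y] assms by simp
qed

text \<open>Write \<open>u\<close> as the pair \<open>(a, b)\<close> and \<open>f u\<close> as \<open>(p, q)\<close>. Passing from \<open>x\<close> to
  \<open>u = \<sim> (x \<hookrightarrow> 0)\<close> keeps the first component, and ensures \<open>b \<le> a \<hookrightarrow> \<cc>\<close>, which does not follow
  from \<open>a \<sqinter> b = \<cc>\<close>. Hence \<open>q \<le> f b \<le> f a \<hookrightarrow> \<cc>\<close>, that is \<open>f a \<le> q \<hookrightarrow> \<cc>\<close>. Both sides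
  of \<open>a \<hookrightarrow> u = \<cc> \<hookrightarrow> u\<close> are \<open>b \<hookrightarrow> \<cc>\<close>, and applying \<open>f\<close> gives \<open>q \<hookrightarrow> \<cc> \<le> f a \<hookrightarrow> p\<close>, so
  \<open>f a \<le> p\<close> by modus ponens.\<close>

lemma khis_hom_join_center:
  fixes X Y :: "'a khil"
  assumes X: "khis X" "khil_laws X" and Y: "khis Y" "khil_laws Y"
    and f: "f \<in> khis_hom X Y" and x: "x \<in> carrier X"
  shows "f (x \<squnion>\<^bsub>X\<^esub> \<cc>\<^bsub>X\<^esub>) = f x \<squnion>\<^bsub>Y\<^esub> \<cc>\<^bsub>Y\<^esub>"
proof -
  interpret X: khis X by fact
  interpret Y: khis Y by fact
  interpret CX: bounded_hilbert_inf "C_obj X" using X by (rule bounded_hilbert_inf_C_obj)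
  interpret CY: bounded_hilbert_inf "C_obj Y" using Y by (rule bounded_hilbert_inf_C_obj)
  have f_closed: "f x \<in> carrier Y" and f_neg: "f (\<sim>\<^bsub>X\<^esub> x) = \<sim>\<^bsub>Y\<^esub> (f x)"
    if "x \<in> carrier X" for x
    using f that by (auto simp: khis_hom_def)
  have f_mono: "f x \<sqsubseteq>\<^bsub>Y\<^esub> f y" if "x \<sqsubseteq>\<^bsub>X\<^esub> y" "x \<in> carrier X" "y \<in> carrier X" for x y
    using f that by (auto simp: khis_hom_def)
  have f_imp: "f (x \<hookrightarrow>\<^bsub>X\<^esub> y) = f x \<hookrightarrow>\<^bsub>Y\<^esub> f y" if "x \<in> carrier X" "y \<in> carrier X" for x y
    using f that by (auto simp: khis_hom_def)
  have f_center: "f \<cc>\<^bsub>X\<^esub> = \<cc>\<^bsub>Y\<^esub>"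
    using f by (intro khis_hom_center) unfold_locales
  have zero: "kzero X \<in> carrier X" "kzero Y \<in> carrier Y" "\<sim>\<^bsub>X\<^esub> (kzero X) = kone X" "\<sim>\<^bsub>Y\<^esub> (kzero Y) = kone Y"
    by (metis X.neg_one X.neg_closed X.one(1), metis Y.neg_one Y.neg_closed Y.one(1),
        metis X.neg_one X.neg_neg X.one(1), metis Y.neg_one Y.neg_neg Y.one(1))
  have f_zero: "f (kzero X) = kzero Y"
    by (metis X.neg_one X.one(1) Y.neg_one f_neg khis_hom_one[OF X(1) Y(1) f])
  have f_join_le: "f x \<squnion>\<^bsub>Y\<^esub> \<cc>\<^bsub>Y\<^esub> \<sqsubseteq>\<^bsub>Y\<^esub> f (x \<squnion>\<^bsub>X\<^esub> \<cc>\<^bsub>X\<^esub>)" if "x \<in> carrier X" for x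
    using that f_mono[of \<open>\<cc>\<^bsub>X\<^esub>\<close> "x \<squnion>\<^bsub>X\<^esub> \<cc>\<^bsub>X\<^esub>"]
    by (intro Y.join_center_least) (auto simp: f_mono f_closed f_center)
  \<comment> \<open>In coordinates, \<open>(a, b) \<hookrightarrow> (0, 1)\<close> is the pair of
    the meet of \<open>a \<leadsto> \<zero>\<close> with \<open>b\<close>, and \<open>a\<close>;
    negation swaps the two.\<close>
  define u where "u = \<sim>\<^bsub>X\<^esub> (x \<hookrightarrow>\<^bsub>X\<^esub> kzero X)"
  have u: "u \<in> carrier X"
    using x zero by (simp add: u_def X.imp_closed)
  \<comment> \<open>The formula for the negated implication into the least element is a meet with
    the greatest one. It applies in both algebras because \<open>f\<close> preserves the least
    element, implication and negation.\<close>
  have "kone X \<squnion>\<^bsub>X\<^esub> \<cc>\<^bsub>X\<^esub> = kone X" "kone Y \<squnion>\<^bsub>Y\<^esub> \<cc>\<^bsub>Y\<^esub> = kone Y"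
    by simp_all
  then have u_join: "u \<squnion>\<^bsub>X\<^esub> \<cc>\<^bsub>X\<^esub> = x \<squnion>\<^bsub>X\<^esub> \<cc>\<^bsub>X\<^esub>" and fu_join: "f u \<squnion>\<^bsub>Y\<^esub> \<cc>\<^bsub>Y\<^esub> = f x \<squnion>\<^bsub>Y\<^esub> \<cc>\<^bsub>Y\<^esub>"
    using x zero
    by (simp_all add: u_def f_neg f_imp f_zero f_closed X.imp_closed X.neg_imp_join_center
        Y.neg_imp_join_center X.meet_eq_left_iff Y.meet_eq_left_iff)
  define a where "a = u \<squnion>\<^bsub>X\<^esub> \<cc>\<^bsub>X\<^esub>"
  define b where "b = \<sim>\<^bsub>X\<^esub> u \<squnion>\<^bsub>X\<^esub> \<cc>\<^bsub>X\<^esub>"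
  define p where "p = f u \<squnion>\<^bsub>Y\<^esub> \<cc>\<^bsub>Y\<^esub>"
  define q where "q = \<sim>\<^bsub>Y\<^esub> (f u) \<squnion>\<^bsub>Y\<^esub> \<cc>\<^bsub>Y\<^esub>"
  have ab: "a \<in> carrier (C_obj X)" "b \<in> carrier (C_obj X)"
    using u by (simp_all add: a_def b_def)
  have pq: "p \<in> carrier (C_obj Y)" "q \<in> carrier (C_obj Y)" "f a \<in> carrier (C_obj Y)"
    using u ab C_arrow(2)[OF X(1) Y(1) f] by (simp_all add: p_def q_def f_closed)
  have c: "\<cc>\<^bsub>X\<^esub> \<in> carrier (C_obj X)" "\<cc>\<^bsub>Y\<^esub> \<in> carrier (C_obj Y)"
    by simp_all
  have le_Y: "v \<preceq>\<^bsub>C_obj Y\<^esub> w \<longleftrightarrow> v \<sqsubseteq>\<^bsub>Y\<^esub> w" if "v \<in> carrier (C_obj Y)" "w \<in> carrier (C_obj Y)" for v w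
    using Y(1) that by (rule hle_C_obj_iff)
  have "b \<sqsubseteq>\<^bsub>X\<^esub> a \<hookrightarrow>\<^bsub>X\<^esub> \<cc>\<^bsub>X\<^esub>"
  proof -
    have "kzero X \<sqsubseteq>\<^bsub>X\<^esub> \<cc>\<^bsub>X\<^esub>"
      using X.zero_least by (auto simp: least_def)
    then have "kzero X \<squnion>\<^bsub>X\<^esub> \<cc>\<^bsub>X\<^esub> = \<cc>\<^bsub>X\<^esub>"
      using zero by (intro X.join_eq) (auto simp: X.is_sup_iff)
    moreover have "b = (x \<hookrightarrow>\<^bsub>X\<^esub> kzero X) \<squnion>\<^bsub>X\<^esub> \<cc>\<^bsub>X\<^esub>"
      using x zero by (simp add: b_def u_def X.neg_neg X.imp_closed)
    ultimately have "b = (a \<hookrightarrow>\<^bsub>X\<^esub> \<cc>\<^bsub>X\<^esub>) \<sqinter>\<^bsub>X\<^esub> (kone X \<hookrightarrow>\<^bsub>X\<^esub> (\<sim>\<^bsub>X\<^esub> x \<squnion>\<^bsub>X\<^esub> \<cc>\<^bsub>X\<^esub>))"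
      using x zero by (simp add: X.imp_join_center a_def u_join)
    then show ?thesis
      using ab x by (simp add: X.imp_closed X.imp_above)
  qed
  then have "f b \<sqsubseteq>\<^bsub>Y\<^esub> f a \<hookrightarrow>\<^bsub>Y\<^esub> \<cc>\<^bsub>Y\<^esub>"
    using ab f_mono[of b "a \<hookrightarrow>\<^bsub>X\<^esub> \<cc>\<^bsub>X\<^esub>"] by (simp add: f_imp f_center X.imp_closed)
  moreover have "q \<sqsubseteq>\<^bsub>Y\<^esub> f b"
    using f_join_le[of "\<sim>\<^bsub>X\<^esub> u"] u by (simp add: q_def b_def f_neg)
  ultimately have "q \<sqsubseteq>\<^bsub>Y\<^esub> f a \<hookrightarrow>\<^bsub>Y\<^esub> \<cc>\<^bsub>Y\<^esub>"
    using pq ab Y.le_trans[of q "f b"] by (simp add: f_closed Y.imp_closed)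
  then have fa_le: "f a \<sqsubseteq>\<^bsub>Y\<^esub> q \<hookrightarrow>\<^bsub>Y\<^esub> \<cc>\<^bsub>Y\<^esub>"
    using CY.hle_imp_swap[OF pq(3,2) c(2)] pq le_Y CY.imp_closed[OF pq(3) c(2)] CY.imp_closed[OF pq(2) c(2)]
    by simp
  \<comment> \<open>Compared coordinatewise: the second coordinates are the meets of
    \<open>b\<close> with \<open>a\<close> and with c, both equal to c; the first ones have the
    factors \<open>a \<hookrightarrow> a\<close> and \<open>\<cc> \<hookrightarrow> a\<close>, both
    equal to the greatest element, beside the common factor
    \<open>b \<hookrightarrow> \<cc>\<close>.\<close>
  have "a \<hookrightarrow>\<^bsub>X\<^esub> u = \<cc>\<^bsub>X\<^esub> \<hookrightarrow>\<^bsub>X\<^esub> u"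
  proof -
    have "a \<sqinter>\<^bsub>X\<^esub> b = \<cc>\<^bsub>X\<^esub>"
      unfolding a_def b_def using X.kleene[OF u] by (rule X.meet_eq)
    moreover have "\<cc>\<^bsub>X\<^esub> \<sqinter>\<^bsub>X\<^esub> b = \<cc>\<^bsub>X\<^esub>"
      using ab by (simp add: X.meet_eq_left_iff)
    ultimately have "\<sim>\<^bsub>X\<^esub> (a \<hookrightarrow>\<^bsub>X\<^esub> u) \<squnion>\<^bsub>X\<^esub> \<cc>\<^bsub>X\<^esub> = \<sim>\<^bsub>X\<^esub> (\<cc>\<^bsub>X\<^esub> \<hookrightarrow>\<^bsub>X\<^esub> u) \<squnion>\<^bsub>X\<^esub> \<cc>\<^bsub>X\<^esub>"
      using ab u by (simp add: X.neg_imp_join_center flip: b_def)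
    moreover have "\<cc>\<^bsub>X\<^esub> \<hookrightarrow>\<^bsub>X\<^esub> a = kone X"
      using CX.zero_imp[OF ab(1)] by simp
    then have "(a \<hookrightarrow>\<^bsub>X\<^esub> u) \<squnion>\<^bsub>X\<^esub> \<cc>\<^bsub>X\<^esub> = (\<cc>\<^bsub>X\<^esub> \<hookrightarrow>\<^bsub>X\<^esub> u) \<squnion>\<^bsub>X\<^esub> \<cc>\<^bsub>X\<^esub>"
      using ab u X by (simp add: X.imp_join_center_of_above X.K3 flip: a_def)
    ultimately show ?thesis
      using ab u X.le_iff_joins[of "a \<hookrightarrow>\<^bsub>X\<^esub> u" "\<cc>\<^bsub>X\<^esub> \<hookrightarrow>\<^bsub>X\<^esub> u"] X.le_iff_joins[of "\<cc>\<^bsub>X\<^esub> \<hookrightarrow>\<^bsub>X\<^esub> u" "a \<hookrightarrow>\<^bsub>X\<^esub> u"]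
      by (simp add: X.imp_closed X.le_antisym)
  qed
  then have "f a \<hookrightarrow>\<^bsub>Y\<^esub> f u = \<cc>\<^bsub>Y\<^esub> \<hookrightarrow>\<^bsub>Y\<^esub> f u"
    using ab u f_imp[of a u] f_imp[of "\<cc>\<^bsub>X\<^esub>" u] by (simp add: f_center)
  then have "(f a \<hookrightarrow>\<^bsub>Y\<^esub> f u) \<squnion>\<^bsub>Y\<^esub> \<cc>\<^bsub>Y\<^esub> = (\<cc>\<^bsub>Y\<^esub> \<hookrightarrow>\<^bsub>Y\<^esub> f u) \<squnion>\<^bsub>Y\<^esub> \<cc>\<^bsub>Y\<^esub>"
    by simp
  then have "(f a \<hookrightarrow>\<^bsub>Y\<^esub> p) \<sqinter>\<^bsub>Y\<^esub> (q \<hookrightarrow>\<^bsub>Y\<^esub> \<cc>\<^bsub>Y\<^esub>) = (\<cc>\<^bsub>Y\<^esub> \<hookrightarrow>\<^bsub>Y\<^esub> p) \<sqinter>\<^bsub>Y\<^esub> (q \<hookrightarrow>\<^bsub>Y\<^esub> \<cc>\<^bsub>Y\<^esub>)"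
    using pq u Y by (simp add: Y.imp_join_center_of_above f_closed flip: p_def q_def)
  also have "\<dots> = q \<hookrightarrow>\<^bsub>Y\<^esub> \<cc>\<^bsub>Y\<^esub>"
    using CY.zero_imp[OF pq(1)] CY.meet_one(1)[OF CY.imp_closed[OF pq(2) c(2)]] by simp
  finally have "q \<hookrightarrow>\<^bsub>Y\<^esub> \<cc>\<^bsub>Y\<^esub> \<sqsubseteq>\<^bsub>Y\<^esub> f a \<hookrightarrow>\<^bsub>Y\<^esub> p"
    using pq Y.meet_above(2)[of "f a \<hookrightarrow>\<^bsub>Y\<^esub> p" "q \<hookrightarrow>\<^bsub>Y\<^esub> \<cc>\<^bsub>Y\<^esub>"]
    by (simp add: Y.imp_closed Y.imp_above)
  then have "f a \<sqsubseteq>\<^bsub>Y\<^esub> f a \<hookrightarrow>\<^bsub>Y\<^esub> p"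
    using pq Y.le_trans[OF fa_le] by (simp add: Y.imp_closed)
  then have "f a \<sqsubseteq>\<^bsub>Y\<^esub> p"
    using CY.modus_ponens[OF pq(3,1,3)] le_Y pq CY.imp_closed[OF pq(3,1)] by simp
  moreover have "p \<sqsubseteq>\<^bsub>Y\<^esub> f a"
    unfolding p_def a_def using u by (rule f_join_le)
  ultimately have "f a = p"
    using pq by (simp add: Y.le_antisym)
  then show ?thesis
    by (simp add: a_def p_def u_join fu_join)
qed

section \<open>The components of \<beta> and their naturality\<close>

lemma is_iso_beta:
  fixes T :: "'a univ khil" (structure)
  assumes "T \<in> Obj KHil0_CK"
  shows "is_iso KHil0_CK T (K_obj (C_obj T)) (beta T)"
proof -
  have T: "khis T" "khil_laws T" "CK T"
    using assms by auto
  interpret khis T by fact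
  interpret CT: hilbert_univ "C_obj T"
    by (intro hilbert_univ.intro bounded_hilbert_inf_C_obj T)
  have beta: "beta T x = UPair (x \<squnion> \<cc>) (\<sim> x \<squnion> \<cc>)" if "x \<in> carrier T" for x
    using that by (simp add: beta_def)
  \<comment> \<open>Disjointness of the two coordinates is the Kleene condition.\<close>
  have cl: "beta T x \<in> carrier (K_obj (C_obj T))" if "x \<in> carrier T" for x
    using that meet_eq[OF kleene[OF that]] by (simp add: beta)
  have le: "beta T x \<sqsubseteq>\<^bsub>K_obj (C_obj T)\<^esub> beta T y \<longleftrightarrow> x \<sqsubseteq> y" if "x \<in> carrier T" "y \<in> carrier T" for x y
    using that by (simp add: beta hle_C_obj_iff T le_iff_joins[of x y])
  show ?thesis
  proof (rule is_iso_KHil0_CKI)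
    show "beta T \<in> extensional (carrier T)"
      by (simp add: beta_def)
    have "inj_on (beta T) (carrier T)"
      using le cl by (metis inj_onI le_antisym le_refl)
    moreover have "p \<in> beta T ` carrier T" if p: "p \<in> carrier (K_obj (C_obj T))" for p
    proof -
      obtain a b where ab: "p = UPair a b" "a \<in> carrier T" "\<cc> \<sqsubseteq> a" "b \<in> carrier T" "\<cc> \<sqsubseteq> b" "a \<sqinter> b = \<cc>"
        using p by (elim CT.K_objE) auto
      \<comment> \<open>The value of \<open>\<sqinter>\<close> alone does not assert that an infimum
        exists, which \<open>CK\<close> requires; it exists because \<open>a\<close> is above
        c.\<close>
      then have "is_inf T \<cc> a b"
        using is_inf_meet[of a b] by simp
      then obtain z where "z \<in> carrier T" "z \<squnion> \<cc> = a" "\<sim> z \<squnion> \<cc> = b"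
        using T(3) ab unfolding CK_def by blast
      then show ?thesis
        using ab beta by (intro image_eqI[of _ _ z]) auto
    qed
    ultimately show "bij_betw (beta T) (carrier T) (carrier (K_obj (C_obj T)))"
      using cl by (auto simp: bij_betw_def)
  next
    fix x y assume xy: "x \<in> carrier T" "y \<in> carrier T"
    show "beta T (\<sim> x) = \<sim>\<^bsub>K_obj (C_obj T)\<^esub> (beta T x)"
      using xy by (simp add: beta neg_neg)
    show "beta T (x \<hookrightarrow> y) = beta T x \<hookrightarrow>\<^bsub>K_obj (C_obj T)\<^esub> beta T y"
      using xy K5[of x "\<sim> y"] by (simp add: beta neg_neg imp_closed neg_imp_join_center)
  qed (use T CT.khis_K_obj le in auto)
qed

lemma natural_isomorphism_beta:
  "natural_isomorphism KHil0_CK KHil0_CK identity_functor (functor_comp K_functor C_functor) beta"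
proof (intro natural_isomorphism.intro natural_isomorphism_axioms.intro
    natural_transformation.intro natural_transformation_axioms.intro
    covariant_functor_identity category_KHil0_CK
    covariant_functor_comp[OF covariant_functor_C covariant_functor_K])
  fix X :: "'a univ khil" assume "X \<in> Obj KHil0_CK"
  then show "is_iso KHil0_CK (omap identity_functor X) (omap (functor_comp K_functor C_functor) X) (beta X)"
    by (simp add: identity_functor_def functor_comp_def C_functor_def K_functor_def is_iso_beta del: KHil0_CK_sel)
  then show "beta X \<in> Hom KHil0_CK (omap identity_functor X) (omap (functor_comp K_functor C_functor) X)"
    unfolding is_iso_def by blast
next
  fix X Y :: "'a univ khil" and f
  assume X: "X \<in> Obj KHil0_CK" and Y: "Y \<in> Obj KHil0_CK" and f: "f \<in> Hom KHil0_CK X Y"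
  interpret X: khis X using X by simp
  have f_closed: "f x \<in> carrier Y" if "x \<in> carrier X" for x
    using f that by (auto simp: khis_hom_def)
  have f_neg: "f (\<sim>\<^bsub>X\<^esub> x) = \<sim>\<^bsub>Y\<^esub> (f x)" if "x \<in> carrier X" for x
    using f that by (auto simp: khis_hom_def)
  \<comment> \<open>The naturality square at \<open>x\<close> asks for this identity at
    \<open>x\<close> in the first coordinate and at \<open>\<sim> x\<close> in the second.\<close>
  have f_join: "f (x \<squnion>\<^bsub>X\<^esub> \<cc>\<^bsub>X\<^esub>) = f x \<squnion>\<^bsub>Y\<^esub> \<cc>\<^bsub>Y\<^esub>" if "x \<in> carrier X" for x
    using X Y f that by (intro khis_hom_join_center) auto
  let ?Kf = "\<lambda>p \<in> carrier (K_obj (C_obj X)).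
    UPair (restrict f (carrier (C_obj X)) (ufst p)) (restrict f (carrier (C_obj X)) (usnd p))"
  have "?Kf (beta X x) = beta Y (f x)" if x: "x \<in> carrier X" for x
  proof -
    have "beta X x \<in> carrier (K_obj (C_obj X))"
      using is_iso_beta[OF X] x by (auto simp: is_iso_def khis_hom_def)
    moreover have "beta X x = UPair (x \<squnion>\<^bsub>X\<^esub> \<cc>\<^bsub>X\<^esub>) (\<sim>\<^bsub>X\<^esub> x \<squnion>\<^bsub>X\<^esub> \<cc>\<^bsub>X\<^esub>)"
      using x by (simp add: beta_def)
    ultimately show ?thesis
      using x f_closed by (simp add: beta_def f_neg f_join)
  qed
  then have "compose (carrier X) (beta Y) f = compose (carrier X) ?Kf (beta X)"
    unfolding compose_def by (intro restrict_ext) simp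
  then show "Comp KHil0_CK (omap identity_functor X) (omap identity_functor Y)
      (omap (functor_comp K_functor C_functor) Y) (beta Y) (amap identity_functor X Y f) =
    Comp KHil0_CK (omap identity_functor X) (omap (functor_comp K_functor C_functor) X)
      (omap (functor_comp K_functor C_functor) Y)
      (amap (functor_comp K_functor C_functor) X Y f) (beta X)"
    by (simp only: identity_functor_def functor_comp_def C_functor_def K_functor_def
        functor_data.simps KHil0_CK_sel)
qed

theorem corollary45:
  shows "category_equivalence
    (Hil0 :: ('a univ hilbert_inf, 'a univ \<Rightarrow> 'a univ) category)
    (KHil0_CK :: ('a univ khil, 'a univ \<Rightarrow> 'a univ) category)
    K_functor C_functor alpha beta"
  using covariant_functor_K covariant_functor_C natural_isomorphism_alpha natural_isomorphism_beta
  by (rule category_equivalence.intro)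

end
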